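(* Let $S$ be a commutative semigroup that generates a divisible group $G = \langle S\rangle$, let $E$ be a (real) Banach lattice, and let $\mathcal{T} = (T_t)_{t\in S}\subseteq \mathcal{L}(E)$ be a positive and bounded representation of $S$ on $E$ such that $T_s$ is AM-compact for some $s\in S$. Assume in addition that $\mathcal{T}$ possesses a quasi-interior fixed point. Then $\mathcal{T}$ is strongly convergent.
   Context: All Banach lattices are real. A representation of a (commutative, additively written) semigroup $S$ on a Banach space $E$ is a family $(T_t)_{t\in S}\subseteq\mathcal{L}(E)$ of bounded linear operators with $T_{t+s}=T_tT_s$ for all $t,s\in S$. It is bounded if $\sup_{t\in S}\|T_t\|<\infty$ and positive if each $T_t$ is a positive operator (maps $E_+$ into $E_+$). A commutative semigroup $S$ generates a group $G$ if $S$ embeds into a group (equivalently $S$ is cancellative) and, viewing $S$ as a subset of that group, $G=\langle S\rangle$ is the smallest subgroup containing $S$ (this is unique up to isomorphism). A group $G$ is divisible if for every $t\in G$ and every $n\in\{1,2,\dots\}$ there is $s\in G$ with $s^n=t$ (additively: $ns=t$). A vector $y\in E_+$ is a quasi-interior point of $E_+$ if the principal ideal $E_y=\{g\in E:\exists c\ge0,\ |g|\le cy\}$ is dense in $E$. A fixed point of $\mathcal T$ is a vector $x$ with $T_tx=x$ for all $t\in S$; "$\mathcal T$ possesses a quasi-interior fixed point" means that some fixed point of $\mathcal T$ is a quasi-interior point of $E_+$. A linear operator $T:E\to Y$ from a Banach lattice to a Banach space is AM-compact if it maps order intervals $[f,g]=\{x\in E: f\le x\le g\}$ to relatively compact subsets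 of $Y$. $S$ is directed by $s\le t :\Leftrightarrow t=s$ or $t=s+r$ for some $r\in S$. The representation is strongly convergent if for every $x\in E$ the net $(T_tx)_{t\in S}$ converges in norm in $E$, i.e. there is $y\in E$ such that for every $\varepsilon>0$ there is $s\in S$ with $\|T_{s+t}x-y\|\le\varepsilon$ for all $t\in S$. *)

theory Defs
  imports
    "HOL-Analysis.Analysis"
    "HOL-Library.Lattice_Algebras"
    "HOL-Computational_Algebra.Group_Closure"
begin

section \<open>Banach lattices\<close>

class banach_lattice = banach + ordered_real_vector + lattice_ab_group_add_abs +
  assumes norm_lattice_mono: "\<bar>x\<bar> \<le> \<bar>y\<bar> \<Longrightarrow> norm x \<le> norm y"

instance real :: banach_lattice
  by standard (auto simp: sup_real_def)

definition principal_ideal :: "'a::banach_lattice \<Rightarrow> 'a set" where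
  "principal_ideal y = {g. \<exists>c\<ge>0. \<bar>g\<bar> \<le> c *\<^sub>R y}"

definition quasi_interior :: "'a::banach_lattice \<Rightarrow> bool" where
  "quasi_interior y \<longleftrightarrow> 0 \<le> y \<and> closure (principal_ideal y) = UNIV"

definition positive_operator :: "('a::banach_lattice \<Rightarrow> 'b::banach_lattice) \<Rightarrow> bool" where
  "positive_operator T \<longleftrightarrow> linear T \<and> (\<forall>x\<ge>0. 0 \<le> T x)"

definition AM_compact :: "('a::banach_lattice \<Rightarrow> 'b::banach) \<Rightarrow> bool" where
  "AM_compact T \<longleftrightarrow> linear T \<and> (\<forall>f g. compact (closure (T ` {f..g})))"


section \<open>Semigroups inside abelian groups\<close>

text \<open>
  A commutative semigroup that embeds into a group is modelled as a subset, closed under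
  addition, of an abelian group. The subgroup it generates is \<^term>\<open>group_closure S\<close>;
  this subgroup need not be the whole type.
\<close>

definition subsemigroup :: "'g::ab_group_add set \<Rightarrow> bool" where
  "subsemigroup S \<longleftrightarrow> (\<forall>s\<in>S. \<forall>t\<in>S. s + t \<in> S)"

text \<open>The sum below is the \<open>n\<close>-fold multiple of \<open>s\<close>.\<close>

definition divisible :: "'g::ab_group_add set \<Rightarrow> bool" where
  "divisible G \<longleftrightarrow> (\<forall>t\<in>G. \<forall>n::nat. n \<ge> 1 \<longrightarrow> (\<exists>s\<in>G. (\<Sum>i<n. s) = t))"


section \<open>Operator representations\<close>

text \<open>
  A representation is given as a function on the whole ambient group, but only its values
  on \<open>S\<close> are ever constrained or used.
\<close>

definition representation ::
    "'g::ab_group_add set \<Rightarrow> ('g \<Rightarrow> 'e::real_normed_vector \<Rightarrow>\<^sub>L 'e) \<Rightarrow> bool" where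
  "representation S T \<longleftrightarrow> (\<forall>t\<in>S. \<forall>s\<in>S. T (t + s) = T t o\<^sub>L T s)"

definition positive_representation ::
    "'g::ab_group_add set \<Rightarrow> ('g \<Rightarrow> 'e::banach_lattice \<Rightarrow>\<^sub>L 'e) \<Rightarrow> bool" where
  "positive_representation S T \<longleftrightarrow>
     representation S T \<and> (\<forall>t\<in>S. positive_operator (blinfun_apply (T t)))"

text \<open>Boundedness refers to the operator norm, the norm of the type of bounded linear functions.\<close>

definition bounded_representation ::
    "'g::ab_group_add set \<Rightarrow> ('g \<Rightarrow> 'e::real_normed_vector \<Rightarrow>\<^sub>L 'e) \<Rightarrow> bool" where
  "bounded_representation S T \<longleftrightarrow> representation S T \<and> bounded (T ` S)"

definition fixed_point ::
    "'g::ab_group_add set \<Rightarrow> ('g \<Rightarrow> 'e::real_normed_vector \<Rightarrow>\<^sub>L 'e) \<Rightarrow> 'e \<Rightarrow> bool" where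
  "fixed_point S T x \<longleftrightarrow> (\<forall>t\<in>S. blinfun_apply (T t) x = x)"

text \<open>
  Norm convergence of the net \<open>(T t x)\<close>, where \<open>S\<close> is directed by
  \<open>s \<le> t \<longleftrightarrow> t = s \<or> (\<exists>r\<in>S. t = s + r)\<close>.
\<close>

definition strongly_convergent ::
    "'g::ab_group_add set \<Rightarrow> ('g \<Rightarrow> 'e::real_normed_vector \<Rightarrow>\<^sub>L 'e) \<Rightarrow> bool" where
  "strongly_convergent S T \<longleftrightarrow>
     (\<forall>x. \<exists>y. \<forall>\<epsilon>>0. \<exists>s\<in>S. \<forall>t\<in>S. norm (blinfun_apply (T (s + t)) x - y) \<le> \<epsilon>)"

end

theory Submission
  imports Defs
begin

text \<open>
  Since \<open>T\<^sub>s\<close> is AM-compact and the quasi-interior point \<open>h\<close> is fixed, orbits are relatively compact, so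
  the strong closure of the operators contains a projection \<open>P\<close> whose range \<open>F\<close> is acted on by a
  group of positive operators (Jacobs, de Leeuw, Glicksberg). The space \<open>F\<close> is a vector lattice,
  \<open>F \<inter> [0,h]\<close> is compact, and the group permutes the components of \<open>h\<close> in \<open>F\<close>. By compactness, the
  components split for each \<open>\<delta>\<close> into finitely many classes of points connected by \<open>\<delta>\<close>-chains; as the
  group is divisible, it fixes each class. A chain of small steps from \<open>u\<close> to \<open>v\<close> cuts \<open>u - u \<sqinter> v\<close> into
  small disjoint pieces. If this difference were nonzero, a Bessel inequality for Rademacher
  functions would give too many separated partial sums of the pieces in \<open>F \<inter> [0,h]\<close>. Hence the
  group fixes every component, and by Freudenthal's spectral theorem every point of \<open>F\<close>, so that
  \<open>T\<^sub>t x\<close> converges to \<open>P x\<close>.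
\<close>

section \<open>Rademacher functions on a power set\<close>

definition rademacher :: "'i \<Rightarrow> 'i set \<Rightarrow> real" where
  "rademacher i A = (if i \<in> A then 1 else - 1)"

lemma rademacher_square [simp]: "rademacher i A * rademacher i A = 1"
  by (simp add: rademacher_def)

text \<open>Orthogonality: if \<open>i\<close> and \<open>j\<close> differ, toggling the membership
  of \<open>i\<close> in \<open>A\<close> changes the sign of exactly one factor, so the sum equals
  its own negative.\<close>

lemma sum_rademacher_mult:
  assumes "finite I" "i \<in> I" "j \<in> I"
  shows "(\<Sum>A\<in>Pow I. rademacher i A * rademacher j A) = (if i = j then 2 ^ card I else 0)"
proof (cases "i = j")
  case True
  then show ?thesis by (simp add: card_Pow assms(1))
next
  case False
  let ?flip = "\<lambda>A. if i \<in> A then A - {i} else insert i A"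
  have "(\<Sum>A\<in>Pow I. rademacher i A * rademacher j A) =
        (\<Sum>A\<in>Pow I. - (rademacher i A * rademacher j A))"
    by (rule sum.reindex_bij_witness[of _ ?flip ?flip])
      (use False assms in \<open>auto simp: rademacher_def split: if_splits\<close>)
  then show ?thesis using False by (simp add: sum_negf)
qed

text \<open>Bessel's inequality for the indicator function of \<open>f\<close> on
  \<open>Pow I\<close>: the Rademacher functions are orthogonal with square norm
  \<open>2 ^ card I\<close>, and the indicator has square norm \<open>card f\<close>.\<close>

lemma rademacher_bessel:
  assumes I: "finite I" and f: "f \<subseteq> Pow I"
  shows "(\<Sum>i\<in>I. (\<Sum>A\<in>f. rademacher i A)\<^sup>2) \<le> 2 ^ card I * card f"
proof -
  define b where "b i = (\<Sum>A\<in>f. rademacher i A)" for i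
  define g where "g A = (\<Sum>i\<in>I. b i * rademacher i A)" for A
  define B where "B = (\<Sum>i\<in>I. (b i)\<^sup>2)"
  let ?c = "2 ^ card I :: real"
  have fin: "finite f" "finite (Pow I)" using I f finite_subset by auto
  have g2: "(\<Sum>A\<in>Pow I. (g A)\<^sup>2) = ?c * B"
  proof -
    have "(\<Sum>A\<in>Pow I. (g A)\<^sup>2) =
      (\<Sum>A\<in>Pow I. \<Sum>i\<in>I. \<Sum>j\<in>I. b i * b j * (rademacher i A * rademacher j A))"
      by (simp add: g_def power2_eq_square sum_product mult_ac)
    also have "\<dots> = (\<Sum>i\<in>I. \<Sum>j\<in>I. b i * b j * (\<Sum>A\<in>Pow I. rademacher i A * rademacher j A))"
      by (subst sum.swap, rule sum.cong[OF refl], subst sum.swap) (simp add: sum_distrib_left)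
    also have "\<dots> = (\<Sum>i\<in>I. \<Sum>j\<in>I. if i = j then b i * b j * ?c else 0)"
      by (intro sum.cong refl) (simp add: sum_rademacher_mult[OF I])
    also have "\<dots> = ?c * B"
      using I by (simp add: B_def power2_eq_square sum_distrib_left mult_ac)
    finally show ?thesis .
  qed
  have gf: "(\<Sum>A\<in>f. g A) = B"
    unfolding g_def B_def by (subst sum.swap) (simp add: b_def power2_eq_square sum_distrib_left)
  have ind: "(\<Sum>A\<in>Pow I. of_bool (A \<in> f) * k A) = (\<Sum>A\<in>f. k A)" for k :: "_ \<Rightarrow> real"
    using f fin by (simp add: of_bool_def if_distrib[of "\<lambda>x. x * _"] sum.If_cases Int_absorb1
        cong: if_cong)
  \<comment> \<open>\<open>g / ?c\<close> is the orthogonal projection of the indicator onto the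
    span of the Rademacher functions; the square norm of the remainder is expanded.\<close>
  have "0 \<le> (\<Sum>A\<in>Pow I. (of_bool (A \<in> f) - g A / ?c)\<^sup>2)"
    by (intro sum_nonneg) auto
  also have "\<dots> = (\<Sum>A\<in>Pow I. of_bool (A \<in> f) * 1 - 2 / ?c * (of_bool (A \<in> f) * g A)
      + (g A)\<^sup>2 / ?c\<^sup>2)"
    by (intro sum.cong refl) (auto simp: power2_eq_square field_simps)
  also have "\<dots> = (\<Sum>A\<in>Pow I. of_bool (A \<in> f) * 1)
      - 2 / ?c * (\<Sum>A\<in>Pow I. of_bool (A \<in> f) * g A) + (\<Sum>A\<in>Pow I. (g A)\<^sup>2) / ?c\<^sup>2"
    by (simp only: sum.distrib sum_subtractf sum_distrib_left sum_divide_distrib)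
  also have "\<dots> = card f - B / ?c"
    unfolding ind gf g2 by (simp add: power2_eq_square)
  finally have "B \<le> ?c * card f" by (simp add: field_simps)
  then show ?thesis by (simp add: B_def b_def)
qed

text \<open>Summing twice the vectors in \<open>close\<close> over all pairs from \<open>f\<close>
  gives \<open>w i\<close> the weight \<open>m\<^sup>2 - (b i)\<^sup>2\<close>. The first term
  reproduces the full sum, and Bessel's inequality controls the second. The size of \<open>I\<close>
  enters the bound only through \<open>N\<close>.\<close>

lemma norm_sum_le_dense_family:
  fixes w :: "'i \<Rightarrow> 'v::real_normed_vector"
  assumes I: "finite I" and f: "f \<subseteq> Pow I"
    and dense: "2 ^ card I \<le> N * real (card f)"
    and small: "\<And>i. i \<in> I \<Longrightarrow> norm (w i) \<le> d"
    and close: "\<And>A B. A \<in> f \<Longrightarrow> B \<in> f \<Longrightarrow> norm (sum w (A - B) + sum w (B - A)) \<le> r"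
  shows "norm (sum w I) \<le> 2 * r + \<bar>d\<bar> * N"
proof -
  define b where "b i = (\<Sum>A\<in>f. rademacher i A)" for i
  define m where "m = real (card f)"
  have fin: "finite f" using I f finite_subset by auto
  have "m \<noteq> 0"
  proof
    assume "m = 0"
    then have "(2::real) ^ card I \<le> 0" using dense by (simp add: m_def)
    moreover have "(0::real) < 2 ^ card I" by simp
    ultimately show False by linarith
  qed
  then have m: "m > 0" by (simp add: m_def)
  have sub: "sum w C = (\<Sum>i\<in>I. of_bool (i \<in> C) *\<^sub>R w i)" if "C \<subseteq> I" for C
  proof -
    have "(\<Sum>i\<in>I. of_bool (i \<in> C) *\<^sub>R w i) = (\<Sum>i\<in>I. if i \<in> C then w i else 0)"
      by (intro sum.cong) auto
    also have "\<dots> = sum w (I \<inter> C)" using I by (simp add: sum.inter_restrict)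
    finally show ?thesis using that by (simp add: Int_absorb1)
  qed
  \<comment> \<open>The coefficient \<open>1 - rademacher i A * rademacher i B\<close> is
    \<open>2\<close> if \<open>i\<close> lies in the symmetric difference of \<open>A\<close> and
    \<open>B\<close>, and \<open>0\<close> otherwise.\<close>
  have D: "2 *\<^sub>R (sum w (A - B) + sum w (B - A)) =
      (\<Sum>i\<in>I. (1 - rademacher i A * rademacher i B) *\<^sub>R w i)" if "A \<in> f" "B \<in> f" for A B
  proof -
    have "A - B \<subseteq> I" "B - A \<subseteq> I" using that f by auto
    then have "2 *\<^sub>R (sum w (A - B) + sum w (B - A)) =
      (\<Sum>i\<in>I. 2 *\<^sub>R (of_bool (i \<in> A - B) *\<^sub>R w i + of_bool (i \<in> B - A) *\<^sub>R w i))"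
      by (simp only: sub sum.distrib scaleR_sum_right scaleR_add_right)
    also have "\<dots> = (\<Sum>i\<in>I. (1 - rademacher i A * rademacher i B) *\<^sub>R w i)"
      by (intro sum.cong refl) (auto simp: rademacher_def scaleR_2)
    finally show ?thesis .
  qed
  have "(\<Sum>A\<in>f. \<Sum>B\<in>f. 2 *\<^sub>R (sum w (A - B) + sum w (B - A))) =
      (\<Sum>A\<in>f. \<Sum>B\<in>f. \<Sum>i\<in>I. (1 - rademacher i A * rademacher i B) *\<^sub>R w i)"
    by (intro sum.cong refl D)
  also have "\<dots> = (\<Sum>i\<in>I. \<Sum>A\<in>f. \<Sum>B\<in>f. (1 - rademacher i A * rademacher i B) *\<^sub>R w i)"
    by (subst sum.swap[of _ I]) (intro sum.cong refl sum.swap)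
  also have "\<dots> = (\<Sum>i\<in>I. (m\<^sup>2 - (b i)\<^sup>2) *\<^sub>R w i)"
    by (intro sum.cong refl)
      (simp add: b_def m_def power2_eq_square sum_product sum_subtractf flip: scaleR_sum_left)
  also have "\<dots> = m\<^sup>2 *\<^sub>R sum w I - (\<Sum>i\<in>I. (b i)\<^sup>2 *\<^sub>R w i)"
    by (simp add: scaleR_left_diff_distrib sum_subtractf scaleR_sum_right)
  finally have eq: "m\<^sup>2 *\<^sub>R sum w I =
      (\<Sum>A\<in>f. \<Sum>B\<in>f. 2 *\<^sub>R (sum w (A - B) + sum w (B - A))) + (\<Sum>i\<in>I. (b i)\<^sup>2 *\<^sub>R w i)"
    by simp
  have "norm (\<Sum>A\<in>f. \<Sum>B\<in>f. 2 *\<^sub>R (sum w (A - B) + sum w (B - A))) \<le> (\<Sum>A\<in>f. \<Sum>B\<in>f. 2 * r)"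
    by (intro sum_norm_le) (simp add: close)
  also have "\<dots> = m\<^sup>2 * (2 * r)" by (simp add: m_def power2_eq_square)
  finally have 1: "norm (\<Sum>A\<in>f. \<Sum>B\<in>f. 2 *\<^sub>R (sum w (A - B) + sum w (B - A))) \<le> m\<^sup>2 * (2 * r)" .
  have "norm (\<Sum>i\<in>I. (b i)\<^sup>2 *\<^sub>R w i) \<le> (\<Sum>i\<in>I. (b i)\<^sup>2 * \<bar>d\<bar>)"
    by (intro sum_norm_le) (use small in \<open>force intro!: mult_left_mono\<close>)
  also have "\<dots> = (\<Sum>i\<in>I. (b i)\<^sup>2) * \<bar>d\<bar>" by (simp add: sum_distrib_right)
  also have "\<dots> \<le> (2 ^ card I * m) * \<bar>d\<bar>"
    using rademacher_bessel[OF I f] by (intro mult_right_mono) (simp_all add: b_def m_def)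
  also have "\<dots> \<le> (N * m * m) * \<bar>d\<bar>"
    using dense m by (intro mult_right_mono) (simp_all add: m_def)
  also have "\<dots> = m\<^sup>2 * (\<bar>d\<bar> * N)" by (simp add: power2_eq_square)
  finally have 2: "norm (\<Sum>i\<in>I. (b i)\<^sup>2 *\<^sub>R w i) \<le> m\<^sup>2 * (\<bar>d\<bar> * N)" .
  have "m\<^sup>2 * norm (sum w I) = norm (m\<^sup>2 *\<^sub>R sum w I)" by simp
  also have "\<dots> \<le> m\<^sup>2 * (2 * r) + m\<^sup>2 * (\<bar>d\<bar> * N)"
    unfolding eq by (rule norm_triangle_mono[OF 1 2])
  also have "\<dots> = m\<^sup>2 * (2 * r + \<bar>d\<bar> * N)" by (simp add: algebra_simps)
  finally show ?thesis using m by simp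
qed

section \<open>Banach lattices\<close>

declare neg_inf_eq_sup [simp del] neg_sup_eq_inf [simp del]
  diff_inf_eq_sup [simp del] diff_sup_eq_inf [simp del]

section \<open>Continuity of the infimum and closedness of the cone\<close>

lemma inf_add_le_add_inf:
  fixes a b c :: "'a::banach_lattice"
  assumes "0 \<le> a" "0 \<le> b" "0 \<le> c"
  shows "inf (a + b) c \<le> inf a c + inf b c"
proof -
  have "c \<le> a + c" "c \<le> c + b" "c \<le> c + c" using assms by simp_all
  then have "inf (a + b) c \<le> inf (inf (a + b) (a + c)) (inf (c + b) (c + c))"
    by (intro inf_greatest) (auto intro: le_infI2)
  also have "\<dots> = inf a c + inf b c"
    by (simp only: add_inf_distrib_left add_inf_distrib_right inf_aci)
  finally show ?thesis .
qed

lemma inf_le_inf_add_abs: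
  fixes a b c d :: "'a::banach_lattice"
  shows "inf a c \<le> inf b d + (\<bar>a - b\<bar> + \<bar>c - d\<bar>)"
proof -
  let ?r = "\<bar>a - b\<bar> + \<bar>c - d\<bar>"
  have "a - b \<le> ?r" "c - d \<le> ?r"
    using add_mono[OF abs_ge_self[of "a - b"] abs_ge_zero[of "c - d"]]
      add_mono[OF abs_ge_zero[of "a - b"] abs_ge_self[of "c - d"]] by simp_all
  then have "a \<le> b + ?r" "c \<le> d + ?r" by (simp_all add: algebra_simps)
  then have "inf a c \<le> inf (b + ?r) (d + ?r)" by (rule inf_mono)
  then show ?thesis by (simp only: add_inf_distrib_right)
qed

lemma abs_inf_diff_le:
  fixes a b c d :: "'a::banach_lattice"
  shows "\<bar>inf a c - inf b d\<bar> \<le> \<bar>a - b\<bar> + \<bar>c - d\<bar>"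
  using inf_le_inf_add_abs[of a c b d] inf_le_inf_add_abs[of b d a c]
  by (intro abs_leI) (simp_all add: algebra_simps abs_minus_commute)

lemma norm_abs_lattice [simp]: "norm \<bar>x\<bar> = norm x" for x :: "'a::banach_lattice"
  by (intro antisym norm_lattice_mono) simp_all

lemma norm_mono_nonneg: "0 \<le> x \<Longrightarrow> x \<le> y \<Longrightarrow> norm x \<le> norm y" for x :: "'a::banach_lattice"
  by (intro norm_lattice_mono) simp

lemma norm_le_of_abs_le: "\<bar>x\<bar> \<le> y \<Longrightarrow> norm x \<le> norm y" for x :: "'a::banach_lattice"
  by (intro norm_lattice_mono) (use order_trans[OF _ abs_ge_self] in blast)

lemma norm_inf_diff_le:
  fixes a b c d :: "'a::banach_lattice"
  shows "norm (inf a c - inf b d) \<le> norm (a - b) + norm (c - d)"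
proof -
  have "norm (inf a c - inf b d) \<le> norm (\<bar>a - b\<bar> + \<bar>c - d\<bar>)"
    by (rule norm_le_of_abs_le[OF abs_inf_diff_le])
  also have "\<dots> \<le> norm (a - b) + norm (c - d)"
    by (rule norm_triangle_le) simp
  finally show ?thesis .
qed

lemma tendsto_inf_lattice:
  fixes f g :: "'b \<Rightarrow> 'a::banach_lattice"
  assumes "(f \<longlongrightarrow> a) F" "(g \<longlongrightarrow> b) F"
  shows "((\<lambda>x. inf (f x) (g x)) \<longlongrightarrow> inf a b) F"
proof -
  have "((\<lambda>x. norm (f x - a) + norm (g x - b)) \<longlongrightarrow> 0) F"
    using tendsto_add[OF tendsto_norm_zero[OF LIM_zero[OF assms(1)]]
        tendsto_norm_zero[OF LIM_zero[OF assms(2)]]] by simp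
  then have "((\<lambda>x. inf (f x) (g x) - inf a b) \<longlongrightarrow> 0) F"
    by (rule Lim_null_comparison[rotated]) (simp add: norm_inf_diff_le)
  then show ?thesis by (simp add: LIM_zero_iff)
qed

lemma closed_nonneg_lattice: "closed {x :: 'a::banach_lattice. 0 \<le> x}"
proof -
  have "continuous_on UNIV (\<lambda>x::'a. inf 0 x)"
    unfolding continuous_on_def by (intro ballI tendsto_inf_lattice tendsto_intros)
  then have "closed {x \<in> UNIV. inf 0 x = (0::'a)}"
    by (intro continuous_closed_preimage_constant) auto
  then show ?thesis by (simp add: le_iff_inf)
qed

lemma closed_atLeastAtMost_lattice: "closed {a..b :: 'a::banach_lattice}"
proof -
  have "{a..b} = (\<lambda>x. x - a) -` {x. 0 \<le> x} \<inter> (\<lambda>x. b - x) -` {x. 0 \<le> x}" by auto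
  moreover have "closed \<dots>"
    by (intro closed_Int closed_vimage closed_nonneg_lattice continuous_intros)
  ultimately show ?thesis by simp
qed

lemma nonneg_limit:
  fixes l :: "'a::banach_lattice"
  assumes "(f \<longlongrightarrow> l) F" "F \<noteq> bot" "eventually (\<lambda>x. 0 \<le> f x) F"
  shows "0 \<le> l"
  using Lim_in_closed_set[OF closed_nonneg_lattice _ assms(2,1)] assms(3) by simp

lemma le_limit:
  fixes l m :: "'a::banach_lattice"
  assumes "(f \<longlongrightarrow> l) F" "(g \<longlongrightarrow> m) F" "F \<noteq> bot" "eventually (\<lambda>x. f x \<le> g x) F"
  shows "l \<le> m"
  using nonneg_limit[OF tendsto_diff[OF assms(2,1)] assms(3)] assms(4) by simp

section \<open>Archimedean property and truncation inequalities\<close>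

lemma le_zero_if_le_inverse_scaleR:
  fixes x h :: "'a::banach_lattice"
  assumes "\<And>n. x \<le> (1 / real (Suc n)) *\<^sub>R h"
  shows "x \<le> 0"
proof -
  have "(\<lambda>n. (1 / real (Suc n)) *\<^sub>R h) \<longlonglongrightarrow> 0 *\<^sub>R h"
    using LIMSEQ_inverse_real_of_nat by (intro tendsto_intros) (simp add: field_simps)
  then show ?thesis
    using le_limit[OF tendsto_const _ _ always_eventually, of _ 0 sequentially x] assms by fastforce
qed

text \<open>The excess of the left side over \<open>r *\<^sub>R h\<close> lies below both
  \<open>c - inf c h\<close> and \<open>h - inf c h\<close>. These are the positive and the negative
  part of \<open>c - h\<close>, hence disjoint.\<close>

lemma inf_scaleR_compl_le:
  fixes c h :: "'a::banach_lattice" and r :: real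
  assumes "0 \<le> c" "0 \<le> h" "0 \<le> r" "r \<le> 1"
  shows "inf (r *\<^sub>R c) (h - inf c h) \<le> r *\<^sub>R h"
proof -
  let ?z = "inf (r *\<^sub>R c) (h - inf c h) - r *\<^sub>R h"
  let ?u = "c - inf c h" and ?v = "h - inf c h"
  have uv: "0 \<le> ?u" "0 \<le> ?v" by simp_all
  have disj: "inf ?u ?v = 0"
  proof -
    have "inf c h + inf ?u ?v = inf c h" by (simp only: add_inf_distrib_left) simp
    then show ?thesis by simp
  qed
  have "?z \<le> r *\<^sub>R c - r *\<^sub>R h" by (simp add: le_infI1)
  also have "\<dots> = r *\<^sub>R (?u - ?v)" by (simp add: scaleR_diff_right)
  also have "\<dots> \<le> r *\<^sub>R ?u" using uv assms by (intro scaleR_left_mono) (simp_all add: diff_le_eq)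
  also have "\<dots> \<le> 1 *\<^sub>R ?u" using uv assms by (intro scaleR_right_mono)
  finally have 1: "?z \<le> ?u" by simp
  have "0 \<le> r *\<^sub>R h" using assms by (simp add: scaleR_nonneg_nonneg)
  then have "?z \<le> inf (r *\<^sub>R c) ?v" by (simp only: diff_le_eq le_add_same_cancel1)
  also have "\<dots> \<le> ?v" by simp
  finally have 2: "?z \<le> ?v" .
  from 1 2 disj have "?z \<le> 0" by (metis inf_greatest)
  then show ?thesis by simp
qed

lemma inf_scaleR_le_0:
  fixes p q :: "'a::banach_lattice"
  assumes "inf p q = 0" "0 \<le> q" "1 \<le> r"
  shows "inf (r *\<^sub>R p) q \<le> 0"
proof -
  let ?z = "inf (r *\<^sub>R p) q"
  have "q \<le> r *\<^sub>R q" using scaleR_right_mono[OF assms(3,2)] by simp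
  then have "?z \<le> r *\<^sub>R q" by (rule le_infI2)
  then have "(1 / r) *\<^sub>R ?z \<le> (1 / r) *\<^sub>R (r *\<^sub>R p)" "(1 / r) *\<^sub>R ?z \<le> (1 / r) *\<^sub>R (r *\<^sub>R q)"
    using assms(3) by (intro scaleR_left_mono; simp)+
  then have "(1 / r) *\<^sub>R ?z \<le> inf p q" using assms(3) by simp
  then have "r *\<^sub>R ((1 / r) *\<^sub>R ?z) \<le> r *\<^sub>R 0" 
    using assms(1,3) by (intro scaleR_left_mono) simp_all
  then show ?thesis using assms(3) by simp
qed

lemma inf_pprt_nprt: "inf (pprt d) (pprt (- d)) = 0" for d :: "'a::banach_lattice"
proof -
  have "nprt d + inf (pprt d) (pprt (- d)) = inf d 0"
    using prts[of d] by (simp add: add_inf_distrib_left pprt_neg add.commute)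
  then show ?thesis by (simp add: nprt_def)
qed

text \<open>The excess of the left side lies below a multiple of \<open>pprt d\<close> and below
  \<open>pprt (- d)\<close>, which are disjoint. This yields the lower half of the spectral
  sandwich.\<close>

lemma inf_scaleR_pprt_add_le:
  fixes d h :: "'a::banach_lattice"
  assumes "0 \<le> r"
  shows "inf (r *\<^sub>R pprt d) h + pprt d \<le> pprt (d + h)"
proof -
  let ?p = "pprt d" and ?q = "pprt (- d)"
  let ?a = "inf (r *\<^sub>R ?p) h"
  have p: "?p = d + ?q" using prts[of d] by (simp add: pprt_neg algebra_simps)
  have "?a + ?p - pprt (d + h) \<le> ?a + ?p - 0" by (intro diff_left_mono) simp
  also have "\<dots> \<le> r *\<^sub>R ?p + ?p" by simp
  also have "\<dots> = (r + 1) *\<^sub>R ?p" by (simp add: scaleR_left_distrib)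
  finally have 1: "?a + ?p - pprt (d + h) \<le> (r + 1) *\<^sub>R ?p" .
  have "?a + ?p - pprt (d + h) \<le> h + ?p - (d + h)"
    by (intro diff_mono add_mono) (simp_all add: pprt_def)
  also have "\<dots> = ?q" by (subst p) simp
  finally have "?a + ?p - pprt (d + h) \<le> ?q" .
  with 1 have "?a + ?p - pprt (d + h) \<le> inf ((r + 1) *\<^sub>R ?p) ?q" by (rule inf_greatest)
  also have "\<dots> \<le> 0" using assms by (intro inf_scaleR_le_0 inf_pprt_nprt) simp_all
  finally show ?thesis by simp
qed

lemma pprt_scaleR: "0 \<le> r \<Longrightarrow> pprt (r *\<^sub>R x) = r *\<^sub>R pprt x" for x :: "'a::banach_lattice"
proof (cases "r = 0")
  case False
  assume "0 \<le> r"
  with False have r: "r > 0" by simp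
  have le: "pprt (s *\<^sub>R y) \<le> s *\<^sub>R pprt y" if "s > 0" for s and y :: 'a
    using that scaleR_left_mono[of y "pprt y" s]
    by (simp add: pprt_def scaleR_nonneg_nonneg)
  have "r *\<^sub>R pprt ((1 / r) *\<^sub>R (r *\<^sub>R x)) \<le> r *\<^sub>R ((1 / r) *\<^sub>R pprt (r *\<^sub>R x))"
    using r le[of "1 / r" "r *\<^sub>R x"] by (intro scaleR_left_mono) simp_all
  then show ?thesis using r le[OF r, of x] by (intro antisym) simp_all
qed simp

section \<open>The range of a positive projection\<close>

locale lattice_projection =
  fixes P :: "'e::banach_lattice \<Rightarrow> 'e" and h :: 'e
  assumes bounded_linear_P: "bounded_linear P"
    and P_nonneg: "0 \<le> x \<Longrightarrow> 0 \<le> P x"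
    and P_idem: "P (P x) = P x"
    and P_h: "P h = h"
    and h_nonneg: "0 \<le> h"
    and compact_fixed: "compact {x. P x = x \<and> 0 \<le> x \<and> x \<le> h}"
begin

sublocale P: bounded_linear P by (rule bounded_linear_P)

lemma P_mono: "x \<le> y \<Longrightarrow> P x \<le> P y"
  using P_nonneg[of "y - x"] by (simp add: P.diff)

lemma abs_P_le: "\<bar>P x\<bar> \<le> P \<bar>x\<bar>"
  using P_mono[of x "\<bar>x\<bar>"] P_mono[of "- x" "\<bar>x\<bar>"]
  by (intro abs_leI) (simp_all add: P.neg abs_ge_self abs_ge_minus_self)

definition bnd :: real where
  "bnd = (SOME K. 0 < K \<and> (\<forall>x. norm (P x) \<le> norm x * K))"

lemma bnd: "0 < bnd" "norm (P x) \<le> norm x * bnd"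
  using someI_ex[OF P.pos_bounded] by (auto simp: bnd_def)

text \<open>The infimum in the range of \<open>P\<close>, which is a lattice but not a sublattice in general.\<close>

definition meet :: "'e \<Rightarrow> 'e \<Rightarrow> 'e" where
  "meet x y = P (inf x y)"

lemma P_meet [simp]: "P (meet x y) = meet x y"
  by (simp add: meet_def P_idem)

lemma meet_commute: "meet x y = meet y x"
  by (simp add: meet_def inf_commute)

lemma meet_mono: "x \<le> x' \<Longrightarrow> y \<le> y' \<Longrightarrow> meet x y \<le> meet x' y'"
  unfolding meet_def by (intro P_mono inf_mono)

lemma meet_nonneg: "0 \<le> x \<Longrightarrow> 0 \<le> y \<Longrightarrow> 0 \<le> meet x y"
  unfolding meet_def by (intro P_nonneg) simp

lemma meet_le1: "P x = x \<Longrightarrow> meet x y \<le> x"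
  using P_mono[of "inf x y" x] by (simp add: meet_def)

lemma meet_le2: "P y = y \<Longrightarrow> meet x y \<le> y"
  using meet_le1 meet_commute by metis

lemma meet_greatest: "P z = z \<Longrightarrow> z \<le> x \<Longrightarrow> z \<le> y \<Longrightarrow> z \<le> meet x y"
  using P_mono[of z "inf x y"] by (simp add: meet_def)

lemma meet_add_le: "0 \<le> x \<Longrightarrow> 0 \<le> x' \<Longrightarrow> 0 \<le> y \<Longrightarrow> meet (x + x') y \<le> meet x y + meet x' y"
  using P_mono[OF inf_add_le_add_inf[of x x' y]] by (simp add: meet_def P.add)

lemma meet_sum_eq_0:
  assumes "finite A" "\<And>i. i \<in> A \<Longrightarrow> 0 \<le> w i" "\<And>i. i \<in> A \<Longrightarrow> meet (w i) y = 0" "0 \<le> y"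
  shows "meet (sum w A) y = 0"
  using assms
proof (induction A rule: finite_induct)
  case empty
  then show ?case by (simp add: meet_def inf_absorb1)
next
  case (insert i A)
  have "meet (w i + sum w A) y \<le> meet (w i) y + meet (sum w A) y"
    using insert by (intro meet_add_le sum_nonneg) auto
  also have "\<dots> = 0" using insert by simp
  finally have "meet (w i + sum w A) y \<le> 0" .
  moreover have "0 \<le> meet (w i + sum w A) y"
    using insert by (intro meet_nonneg add_nonneg_nonneg sum_nonneg) auto
  ultimately show ?case using insert by simp
qed

text \<open>Since \<open>P\<close> annihilates \<open>inf a b\<close>, the vector \<open>a\<close>
  is the image of \<open>a - inf a b\<close>, whose norm is at most that of \<open>a - b\<close>. So
  disjoint vectors can be close only if they are small.\<close>

lemma norm_le_of_meet_eq_0: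
  assumes "P a = a" "meet a b = 0"
  shows "norm a \<le> norm (a - b) * bnd"
proof -
  have "a = P (a - inf a b)" using assms by (simp add: P.diff meet_def)
  with bnd(2)[of "a - inf a b"] have "norm a \<le> norm (a - inf a b) * bnd" by simp
  also have "norm (a - inf a b) \<le> norm (a - b)"
    using norm_inf_diff_le[of a a a b] by simp
  finally show ?thesis using bnd(1) by simp
qed

section \<open>Sums of many small disjoint pieces\<close>

definition disjoint_pieces :: "nat \<Rightarrow> (nat \<Rightarrow> 'e) \<Rightarrow> bool" where
  "disjoint_pieces k w \<longleftrightarrow> (\<forall>i<k. P (w i) = w i \<and> 0 \<le> w i) \<and>
     (\<forall>i<k. \<forall>j<k. i \<noteq> j \<longrightarrow> meet (w i) (w j) = 0) \<and> sum w {..<k} \<le> h"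

text \<open>Finitely many small balls cover all partial sums, so one of them contains a positive
  proportion of the \<open>2 ^ k\<close> partial sums.\<close>

lemma disjoint_pieces_small:
  assumes "e > 0"
  obtains d where "d > 0"
    "\<And>k w. disjoint_pieces k w \<Longrightarrow> (\<And>i. i < k \<Longrightarrow> norm (w i) \<le> d) \<Longrightarrow> norm (sum w {..<k}) \<le> e"
proof -
  \<comment> \<open>Two partial sums in one ball differ by less than \<open>2 * \<rho>\<close>;
    bounding both of their disjoint parts costs a factor \<open>2 * bnd\<close>, which gives
    \<open>e / 4\<close>.\<close>
  define \<rho> where "\<rho> = e / (16 * bnd)"
  have \<rho>: "\<rho> > 0" using assms bnd by (simp add: \<rho>_def)
  obtain Z where Z: "finite Z" "{x. P x = x \<and> 0 \<le> x \<and> x \<le> h} \<subseteq> (\<Union>z\<in>Z. ball z \<rho>)"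
    using compact_fixed[unfolded compact_eq_totally_bounded] \<rho> by blast
  \<comment> \<open>Makes \<open>d * card Z\<close> at most \<open>e / 2\<close>; the number
    \<open>k\<close> of pieces does not enter.\<close>
  define d where "d = e / (2 * (card Z + 1))"
  have d: "d > 0" using assms by (simp add: d_def)
  have "norm (sum w {..<k}) \<le> e"
    if D: "disjoint_pieces k w" and small: "\<And>i. i < k \<Longrightarrow> norm (w i) \<le> d" for k w
  proof -
    have w: "P (w i) = w i" "0 \<le> w i" if "i < k" for i
      using D that by (auto simp: disjoint_pieces_def)
    have sums: "P (sum w A) = sum w A" "0 \<le> sum w A" "sum w A \<le> h" if "A \<subseteq> {..<k}" for A
    proof -
      show "P (sum w A) = sum w A" using that w by (subst P.sum) (auto intro!: sum.cong)
      show "0 \<le> sum w A" using that w by (intro sum_nonneg) auto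
      have "sum w A \<le> sum w {..<k}" using that w by (intro sum_mono2) auto
      then show "sum w A \<le> h" using D by (auto simp: disjoint_pieces_def)
    qed
    define f where "f z = {A \<in> Pow {..<k}. sum w A \<in> ball z \<rho>}" for z
    have fin: "finite (f z)" for z by (simp add: f_def)
    have cover: "Pow {..<k} \<subseteq> (\<Union>z\<in>Z. f z)"
    proof
      fix A assume A: "A \<in> Pow {..<k}"
      then have "sum w A \<in> (\<Union>z\<in>Z. ball z \<rho>)" using sums[of A] by (intro subsetD[OF Z(2)]) simp
      then show "A \<in> (\<Union>z\<in>Z. f z)" using A by (auto simp: f_def)
    qed
    then have "Z \<noteq> {}" by auto
    have "\<exists>z\<in>Z. 2 ^ k \<le> card Z * card (f z)"
    proof (rule ccontr)
      assume "\<not> ?thesis"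
      then have less: "card Z * card (f z) < 2 ^ k" if "z \<in> Z" for z using that by auto
      have "2 ^ k = card (Pow {..<k})" by (simp add: card_Pow)
      also have "\<dots> \<le> card (\<Union>z\<in>Z. f z)" using Z fin by (intro card_mono cover) auto
      also have "\<dots> \<le> (\<Sum>z\<in>Z. card (f z))" by (rule card_UN_le[OF Z(1)])
      finally have "card Z * 2 ^ k \<le> (\<Sum>z\<in>Z. card Z * card (f z))"
        by (simp flip: sum_distrib_left)
      also have "\<dots> < (\<Sum>z\<in>Z. 2 ^ k)" using Z \<open>Z \<noteq> {}\<close> less by (intro sum_strict_mono) auto
      finally show False by simp
    qed
    then obtain z where z: "2 ^ k \<le> card Z * card (f z)" by blast
    have "norm (sum w {..<k}) \<le> 2 * (e / 4) + \<bar>d\<bar> * card Z"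
    proof (rule norm_sum_le_dense_family[of _ "f z"])
      show "2 ^ card {..<k} \<le> real (card Z) * real (card (f z))"
        using of_nat_mono[OF z, where 'a = real] by simp
      fix A B assume AB: "A \<in> f z" "B \<in> f z"
      then have sub: "A \<subseteq> {..<k}" "B \<subseteq> {..<k}" by (auto simp: f_def)
      then have finAB: "finite A" "finite B" using finite_subset by auto
      let ?a = "sum w (A - B)" and ?b = "sum w (B - A)"
      have "sum w A - sum w B = (?a + sum w (A \<inter> B)) - (?b + sum w (B \<inter> A))"
        using sum.Int_Diff[OF finAB(1), of w B] sum.Int_Diff[OF finAB(2), of w A]
        by (simp add: add.commute)
      then have diff: "?a - ?b = sum w A - sum w B" by (simp add: Int_commute)
      have "dist (sum w A) (sum w B) < 2 * \<rho>"
        using AB dist_triangle_less_add[of "sum w A" z \<rho> "sum w B" \<rho>]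
        by (auto simp: f_def dist_commute)
      then have near: "norm (?a - ?b) \<le> 2 * \<rho>" by (simp add: diff dist_norm)
      have ab: "meet ?a ?b = 0"
      proof (rule meet_sum_eq_0)
        fix i assume i: "i \<in> A - B"
        have "meet ?b (w i) = 0"
        proof (rule meet_sum_eq_0)
          fix j assume "j \<in> B - A"
          then show "meet (w j) (w i) = 0"
            using i sub D unfolding disjoint_pieces_def by blast
        qed (use i sub w finAB in auto)
        then show "meet (w i) ?b = 0" by (simp add: meet_commute)
      qed (use sub w finAB in \<open>auto intro!: sum_nonneg\<close>)
      have "norm ?a \<le> norm (?a - ?b) * bnd"
        using sub ab by (intro norm_le_of_meet_eq_0 sums) auto
      moreover have "norm ?b \<le> norm (?b - ?a) * bnd"
        using sub ab by (intro norm_le_of_meet_eq_0 sums) (auto simp: meet_commute)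
      ultimately have "norm (?a + ?b) \<le> 2 * (norm (?a - ?b) * bnd)"
        using norm_triangle_ineq[of ?a ?b] by (simp add: norm_minus_commute)
      also have "\<dots> \<le> 2 * (2 * \<rho> * bnd)" using near bnd by simp
      also have "\<dots> = e / 4" using bnd(1) by (simp add: \<rho>_def)
      finally show "norm (?a + ?b) \<le> e / 4" .
    qed (use small in \<open>auto simp: f_def\<close>)
    also have "\<bar>d\<bar> * card Z \<le> e / 2"
      using assms by (simp add: d_def field_simps)
    finally show ?thesis by simp
  qed
  with d that show ?thesis by blast
qed

section \<open>Components of \<open>h\<close> and chains between them\<close>

definition component :: "'e \<Rightarrow> bool" where
  "component u \<longleftrightarrow> P u = u \<and> 0 \<le> u \<and> u \<le> h \<and> meet u (h - u) = 0"

text \<open>The complement of the meet is at most the sum of the two complements, because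
  \<open>u + v - inf u v\<close> is the supremum and thus at most \<open>h\<close>. Each of these
  complements is disjoint from the meet.\<close>

lemma component_meet:
  assumes u: "component u" and v: "component v"
  shows "component (meet u v)"
proof -
  let ?q = "meet u v"
  have q: "0 \<le> ?q" "?q \<le> u" "?q \<le> v" 
    using u v by (auto simp: component_def intro: meet_nonneg meet_le1 meet_le2)
  have "h - inf u v \<le> (h - u) + (h - v)"
  proof -
    have "u + v - inf u v = sup u v" by (subst add_eq_inf_sup) simp
    also have "\<dots> \<le> h" using u v by (simp add: component_def)
    finally show ?thesis by (simp add: algebra_simps)
  qed
  then have "h - ?q \<le> (h - u) + (h - v)"
    using P_mono[of "h - inf u v" "(h - u) + (h - v)"] u v
    by (simp add: P.diff P.add P_h meet_def component_def)
  then have "meet ?q (h - ?q) \<le> meet ?q ((h - u) + (h - v))" by (intro meet_mono) auto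
  also have "\<dots> \<le> meet (h - u) ?q + meet (h - v) ?q"
    using u v q meet_add_le[of "h - u" "h - v" ?q] by (simp add: component_def meet_commute)
  also have "\<dots> \<le> meet (h - u) u + meet (h - v) v"
    using q by (intro add_mono meet_mono) auto
  also have "\<dots> = 0" using u v by (simp add: component_def meet_commute)
  finally have "meet ?q (h - ?q) \<le> 0" .
  moreover have "?q \<le> h" using q u by (auto simp: component_def)
  then have "0 \<le> meet ?q (h - ?q)" using q by (intro meet_nonneg) auto
  ultimately show ?thesis using q \<open>?q \<le> h\<close> by (simp add: component_def)
qed

text \<open>A chain of small steps from \<open>u\<close> to \<open>v\<close> cuts the part of \<open>u\<close> that is lost along
  the way into small disjoint pieces.\<close>

lemma component_le_of_chains:
  assumes u: "component u" and v: "component v"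
    and chain: "\<And>\<delta>. \<delta> > 0 \<Longrightarrow>
      (u, v) \<in> {(a, b). component a \<and> component b \<and> norm (a - b) \<le> \<delta>}\<^sup>*"
  shows "u \<le> v"
proof -
  have le: "norm (u - meet u v) \<le> 0 + e" if e: "e > 0" for e
  proof -
    obtain d where d: "d > 0" and
      small: "\<And>k w. disjoint_pieces k w \<Longrightarrow> (\<And>i. i < k \<Longrightarrow> norm (w i) \<le> d) \<Longrightarrow>
        norm (sum w {..<k}) \<le> e"
      using disjoint_pieces_small[OF e] by blast
    \<comment> \<open>Projecting costs a factor \<open>bnd\<close>, so steps of size
      \<open>d / bnd\<close> lead to pieces of size at most \<open>d\<close>.\<close>
    let ?R = "{(a, b). component a \<and> component b \<and> norm (a - b) \<le> d / bnd}"
    obtain k where "(u, v) \<in> ?R ^^ k"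
      using chain[of "d / bnd"] d bnd(1) rtrancl_imp_relpow by fastforce
    then obtain f where f: "f 0 = u" "f k = v"
      "\<And>i. i < k \<Longrightarrow> component (f i) \<and> component (f (Suc i)) \<and> norm (f i - f (Suc i)) \<le> d / bnd"
      unfolding relpow_fun_conv by auto
    \<comment> \<open>The running meet along the chain: it decreases through components, starts at
      \<open>u\<close> and ends below \<open>f k = v\<close>.\<close>
    define q where "q = rec_nat u (\<lambda>i x. meet x (f (Suc i)))"
    have q_0: "q 0 = u" and q_Suc: "q (Suc i) = meet (q i) (f (Suc i))" for i
      by (simp_all add: q_def)
    have comp: "component (q i) \<and> q i \<le> f i \<and> q i \<le> u" if "i \<le> k" for i
      using that
    proof (induction i)
      case 0
      then show ?case using u f by (simp add: q_0)
    next
      case (Suc i)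
      then have 1: "component (q i)" "q i \<le> u" "component (f (Suc i))" using f(3)[of i] by auto
      have "q (Suc i) \<le> q i" "q (Suc i) \<le> f (Suc i)"
        using 1 unfolding q_Suc by (auto simp: component_def intro: meet_le1 meet_le2)
      then show ?case using 1 component_meet[OF 1(1,3)] by (auto simp: q_Suc)
    qed
    have q_le: "q (Suc i) \<le> q i" if "i < k" for i
      using comp[of i] that unfolding q_Suc by (intro meet_le1) (auto simp: component_def)
    have q_mono: "q j \<le> q i" if "i \<le> j" "j \<le> k" for i j
      using that by (induction j rule: dec_induct) (auto intro: order_trans[OF q_le])
    define w where "w i = q i - q (Suc i)" for i
    have sum_w: "sum w {..<j} = u - q j" for j
      by (induction j) (simp_all add: w_def q_0)
    have w_small: "norm (w i) \<le> d" if i: "i < k" for i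
    proof -
      have c: "component (q i)" "q i \<le> f i" using comp[of i] i by auto
      have "w i = P (q i - inf (q i) (f (Suc i)))"
        using c by (simp add: w_def q_Suc meet_def P.diff component_def)
      with bnd(2)[of "q i - inf (q i) (f (Suc i))"]
      have "norm (w i) \<le> norm (q i - inf (q i) (f (Suc i))) * bnd" by simp
      also have "norm (q i - inf (q i) (f (Suc i))) \<le> norm (f i - f (Suc i))"
        using c(2) norm_inf_diff_le[of "q i" "f i" "q i" "f (Suc i)"] by (simp add: inf_absorb1)
      also have "\<dots> \<le> d / bnd" using f(3) i by simp
      finally show ?thesis using bnd(1) by simp
    qed
    \<comment> \<open>The later piece \<open>w j\<close> lies below \<open>q (Suc i)\<close>, while
      \<open>w i\<close> lies below its complement.\<close>
    have disj: "meet (w i) (w j) = 0" if "i < j" "j < k" for i j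
    proof -
      have c: "component (q (Suc i))" "component (q (Suc j))" "component (q i)"
        using comp that by auto
      have wnn: "0 \<le> w i" "0 \<le> w j" using q_le that by (simp_all add: w_def)
      have "w i \<le> h - q (Suc i)" using c(3) by (simp add: w_def component_def)
      moreover have "w j \<le> q j" using c(2) by (simp add: w_def component_def)
      then have "w j \<le> q (Suc i)" using q_mono[of "Suc i" j] that by simp
      ultimately have "meet (w i) (w j) \<le> meet (h - q (Suc i)) (q (Suc i))"
        by (rule meet_mono)
      also have "\<dots> = 0" using c(1) by (simp add: component_def meet_commute)
      finally show ?thesis using meet_nonneg[OF wnn] by simp
    qed
    have "disjoint_pieces k w"
      unfolding disjoint_pieces_def
    proof (intro conjI allI impI)
      fix i assume "i < k"
      then show "P (w i) = w i" "0 \<le> w i"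
        using comp[of i] comp[of "Suc i"] q_le[of i] by (simp_all add: w_def P.diff component_def)
    next
      fix i j assume "i < k" "j < k" "i \<noteq> j"
      then show "meet (w i) (w j) = 0"
        using disj[of i j] disj[of j i] by (cases i j rule: linorder_cases) (auto simp: meet_commute)
    next
      have "0 \<le> q k" "u \<le> h" using comp[of k] u by (auto simp: component_def)
      then have "u - q k \<le> h - 0" by (intro diff_mono) auto
      then show "sum w {..<k} \<le> h" by (simp add: sum_w)
    qed
    from small[OF this w_small] have "norm (u - q k) \<le> e" by (simp add: sum_w)
    moreover have "norm (u - meet u v) \<le> norm (u - q k)"
    proof (rule norm_mono_nonneg)
      show "0 \<le> u - meet u v" using u by (simp add: meet_le1 component_def)
      have "q k \<le> meet u v"
        using comp[of k] f(2) by (intro meet_greatest) (auto simp: component_def)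
      then show "u - meet u v \<le> u - q k" by (rule diff_left_mono)
    qed
    ultimately show ?thesis by simp
  qed
  have "norm (u - meet u v) \<le> 0" by (rule field_le_epsilon[OF le])
  then have "u - meet u v = 0" by simp
  then have "u = meet u v" by (rule eq_iff_diff_eq_0[THEN iffD2])
  also have "\<dots> \<le> v" using v by (intro meet_le2) (simp add: component_def)
  finally show ?thesis .
qed

text \<open>Equality of \<open>x\<close> and \<open>P x\<close> modulo the null ideal \<open>{y. P \<bar>y\<bar> = 0}\<close>. It is preserved by infima,
  which reduces lattice computations in the range of \<open>P\<close> to computations in the whole space.\<close>

definition almost_fixed :: "'e \<Rightarrow> bool" where
  "almost_fixed x \<longleftrightarrow> P \<bar>x - P x\<bar> = 0"

lemma P_abs_eq_0_mono: "\<bar>x\<bar> \<le> y \<Longrightarrow> P y = 0 \<Longrightarrow> P \<bar>x\<bar> = 0"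
  using P_mono[of "\<bar>x\<bar>" y] P_nonneg[OF abs_ge_zero, of x] by (intro antisym) simp_all

lemma almost_fixedI:
  assumes "x \<le> P x"
  shows "almost_fixed x"
proof -
  have "\<bar>x - P x\<bar> = P x - x" using assms by (subst abs_minus_commute) simp
  then show ?thesis by (simp add: almost_fixed_def P.diff P_idem)
qed

lemma almost_fixed_diff:
  assumes "almost_fixed x" "P y = y"
  shows "almost_fixed (y - x)"
proof -
  have "y - x - P (y - x) = - (x - P x)" using assms(2) by (simp add: P.diff)
  then show ?thesis using assms(1) by (simp only: almost_fixed_def abs_minus_cancel)
qed

text \<open>Replacing \<open>v\<close> and \<open>w\<close> by their images changes the infimum by
  at most the sum of two errors that \<open>P\<close> annihilates. The infimum of the images
  dominates its own image, and \<open>P\<close> annihilates this difference too.\<close>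

lemma almost_fixed_inf:
  assumes "almost_fixed v" "almost_fixed w"
  shows "almost_fixed (inf v w)" and "P (inf v w) = P (inf (P v) (P w))"
proof -
  let ?m = "inf v w" and ?m' = "inf (P v) (P w)"
  have "P (\<bar>v - P v\<bar> + \<bar>w - P w\<bar>) = 0" using assms by (simp add: almost_fixed_def P.add)
  then have d: "P \<bar>?m - ?m'\<bar> = 0" by (rule P_abs_eq_0_mono[OF abs_inf_diff_le])
  then show eq: "P ?m = P ?m'" using abs_P_le[of "?m - ?m'"] by (simp add: P.diff)
  have "P ?m' \<le> ?m'"
    using P_mono[of ?m' "P v"] P_mono[of ?m' "P w"] by (simp add: P_idem)
  then have "P \<bar>?m' - P ?m'\<bar> = 0" by (simp add: P.diff P_idem)
  then have "P (\<bar>?m - ?m'\<bar> + \<bar>?m' - P ?m'\<bar>) = 0" using d by (simp add: P.add)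
  moreover have "\<bar>?m - P ?m\<bar> \<le> \<bar>?m - ?m'\<bar> + \<bar>?m' - P ?m'\<bar>"
    using abs_triangle_ineq[of "?m - ?m'" "?m' - P ?m'"] unfolding eq by simp
  ultimately show "almost_fixed ?m"
    unfolding almost_fixed_def by (rule P_abs_eq_0_mono[rotated])
qed

lemma almost_fixed_pprt: "P z = z \<Longrightarrow> almost_fixed (pprt z)"
  using P_mono[of z "pprt z"] P_nonneg[OF zero_le_pprt, of z]
  by (intro almost_fixedI) (simp add: pprt_def)

text \<open>\<open>e\<close> is the component carried by the region where \<open>z\<close> is
  positive. The truncations \<open>P (inf (r *\<^sub>R pprt z) h)\<close> increase with
  \<open>r\<close>, and compactness of the order interval in the range of \<open>P\<close> provides
  their limit.\<close>

lemma ex_component_of_positive_part: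
  assumes z: "P z = z"
  obtains e where "component e" "\<And>r. 0 \<le> r \<Longrightarrow> P (inf (r *\<^sub>R pprt z) h) \<le> e"
    "\<And>v. (\<And>r. 0 \<le> r \<Longrightarrow> P (inf (r *\<^sub>R pprt z) h) \<le> v) \<Longrightarrow> e \<le> v"
proof -
  let ?y = "pprt z"
  define c where "c r = P (inf (r *\<^sub>R ?y) h)" for r
  have y: "0 \<le> r *\<^sub>R ?y" if "0 \<le> r" for r using that by (simp add: scaleR_nonneg_nonneg)
  have c_mono: "c r \<le> c s" if "r \<le> s" for r s
    unfolding c_def using that by (intro P_mono inf_mono scaleR_right_mono) auto
  have af: "almost_fixed (inf (r *\<^sub>R ?y) h)" if "0 \<le> r" for r
    using almost_fixed_inf(1)[OF almost_fixed_pprt[of "r *\<^sub>R z"], of h] that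
    by (simp add: pprt_scaleR P.scaleR z almost_fixed_def P_h)
  have c_in: "P (c r) = c r" "0 \<le> c r" "c r \<le> h" if "0 \<le> r" for r
    using y[OF that] h_nonneg P_mono[of "inf (r *\<^sub>R ?y) h" h]
    by (simp_all add: c_def P_idem P_nonneg P_h)
  have "\<forall>n. c (real n) \<in> {x. P x = x \<and> 0 \<le> x \<and> x \<le> h}" using c_in by auto
  then obtain e r where e: "e \<in> {x. P x = x \<and> 0 \<le> x \<and> x \<le> h}"
    and r: "strict_mono (r :: nat \<Rightarrow> nat)" and lim: "(\<lambda>n. c (real (r n))) \<longlonglongrightarrow> e"
    using compact_fixed[unfolded compact_def, rule_format, of "\<lambda>n. c (real n)"]
    by (auto simp: o_def)
  have upper: "c s \<le> e" for s
  proof (rule le_limit[OF tendsto_const lim])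
    show "\<forall>\<^sub>F n in sequentially. c s \<le> c (real (r n))"
      unfolding eventually_sequentially
    proof (intro exI allI impI c_mono)
      fix n assume "nat \<lceil>s\<rceil> \<le> n"
      then show "s \<le> real (r n)" using seq_suble[OF r, of n] by linarith
    qed
  qed simp
  have least: "e \<le> v" if "\<And>r. 0 \<le> r \<Longrightarrow> c r \<le> v" for v
    by (rule le_limit[OF lim tendsto_const]) (use that in auto)
  \<comment> \<open>The truncation at level \<open>s\<close> is compared with the complement of the
    one at the higher level \<open>Suc n * s\<close>; \<open>inf_scaleR_compl_le\<close> leaves at
    most \<open>h / Suc n\<close>.\<close>
  have "meet (c s) (h - e) \<le> (1 / real (Suc n)) *\<^sub>R h" if s: "0 \<le> s" for s n
  proof -
    let ?a = "inf (s *\<^sub>R ?y) h" and ?b = "h - inf ((real (Suc n) * s) *\<^sub>R ?y) h"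
    have "meet (c s) (h - e) \<le> meet (c s) (h - c (real (Suc n) * s))"
      using upper by (intro meet_mono diff_left_mono) auto
    also have "\<dots> = P (inf (P ?a) (P ?b))" by (simp add: meet_def c_def P.diff P_h)
    also have "\<dots> = P (inf ?a ?b)"
      using s by (intro almost_fixed_inf(2)[symmetric] almost_fixed_diff af P_h) auto
    also have "\<dots> \<le> P ((1 / real (Suc n)) *\<^sub>R h)"
    proof (rule P_mono)
      have "inf ?a ?b \<le> inf (s *\<^sub>R ?y) ?b" by (intro inf_mono) auto
      also have "\<dots> = inf ((1 / real (Suc n)) *\<^sub>R ((real (Suc n) * s) *\<^sub>R ?y)) ?b" by simp
      also have "\<dots> \<le> (1 / real (Suc n)) *\<^sub>R h"
        using s h_nonneg by (intro inf_scaleR_compl_le y) auto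
      finally show "inf ?a ?b \<le> (1 / real (Suc n)) *\<^sub>R h" .
    qed
    also have "\<dots> = (1 / real (Suc n)) *\<^sub>R h" by (simp only: P.scaleR P_h)
    finally show ?thesis .
  qed
  then have disj: "meet (c s) (h - e) \<le> 0" if "0 \<le> s" for s
    using that by (intro le_zero_if_le_inverse_scaleR) auto
  have "(\<lambda>n. meet (c (real (r n))) (h - e)) \<longlonglongrightarrow> meet e (h - e)"
    unfolding meet_def by (intro P.tendsto tendsto_inf_lattice lim tendsto_const)
  then have "meet e (h - e) \<le> 0"
    by (rule le_limit[OF _ tendsto_const]) (use disj in auto)
  moreover have "0 \<le> meet e (h - e)" using e by (intro meet_nonneg) auto
  ultimately have "component e" using e by (simp add: component_def)
  then show ?thesis using that upper least unfolding c_def by blast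
qed

text \<open>Freudenthal's spectral theorem: the level sets \<open>x > k h / n\<close> sandwich \<open>x\<close> up to \<open>h / n\<close>.\<close>

lemma component_sandwich:
  assumes x: "P x = x" "0 \<le> x" "x \<le> h" and n: "n > 0"
  obtains e where "\<And>k. component (e k)"
    "x \<le> (1 / real n) *\<^sub>R (\<Sum>k<n. e k)" "(1 / real n) *\<^sub>R (\<Sum>k<n. e (Suc k)) \<le> x"
proof -
  define z where "z k = x - (real k / real n) *\<^sub>R h" for k
  have Pz: "P (z k) = z k" for k by (simp add: z_def P.diff P.scaleR x P_h)
  have z_Suc: "z k = z (Suc k) + (1 / real n) *\<^sub>R h" for k
    by (simp add: z_def add_divide_distrib scaleR_left_distrib)
  have "\<exists>e. component e \<and> (\<forall>r\<ge>0. P (inf (r *\<^sub>R pprt (z k)) h) \<le> e) \<and>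
      (\<forall>v. (\<forall>r\<ge>0. P (inf (r *\<^sub>R pprt (z k)) h) \<le> v) \<longrightarrow> e \<le> v)" for k
    by (rule ex_component_of_positive_part[OF Pz[of k]]) blast
  then obtain e where e: "\<And>k. component (e k)"
    "\<And>k r. 0 \<le> r \<Longrightarrow> P (inf (r *\<^sub>R pprt (z k)) h) \<le> e k"
    "\<And>k v. (\<And>r. 0 \<le> r \<Longrightarrow> P (inf (r *\<^sub>R pprt (z k)) h) \<le> v) \<Longrightarrow> e k \<le> v"
    by metis
  \<comment> \<open>Differences of consecutive \<open>?g k\<close> are the horizontal slices of
    \<open>x\<close> between the levels \<open>k / n\<close> and \<open>(k + 1) / n\<close>; nothing
    is left at level \<open>n\<close> because \<open>x \<le> h\<close>.\<close>
  let ?g = "\<lambda>k. pprt (z k)"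
  have "?g 0 = x" using x by (simp add: z_def)
  moreover have "?g n = 0" using x n by (simp add: z_def)
  moreover have "(\<Sum>k<n. ?g k - ?g (Suc k)) = ?g 0 - ?g n" by (rule sum_lessThan_telescope')
  ultimately have tele: "x = (\<Sum>k<n. P (?g k - ?g (Suc k)))"
    using x by (simp flip: P.sum)
  have up: "P (?g k - ?g (Suc k)) \<le> (1 / real n) *\<^sub>R e k" for k
  proof -
    let ?d = "?g k - ?g (Suc k)"
    have "real n *\<^sub>R ?d \<le> real n *\<^sub>R ?g k" by (intro scaleR_left_mono) simp_all
    moreover have "?g k \<le> ?g (Suc k) + (1 / real n) *\<^sub>R h"
      using h_nonneg unfolding z_Suc[of k]
      by (auto simp: pprt_def scaleR_nonneg_nonneg intro: add_nonneg_nonneg)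
    then have "?d \<le> (1 / real n) *\<^sub>R h" by (simp add: algebra_simps)
    then have "real n *\<^sub>R ?d \<le> real n *\<^sub>R ((1 / real n) *\<^sub>R h)"
      by (intro scaleR_left_mono) simp_all
    ultimately have "real n *\<^sub>R ?d \<le> inf (real n *\<^sub>R ?g k) h" using n by simp
    then have "real n *\<^sub>R P ?d \<le> P (inf (real n *\<^sub>R ?g k) h)"
      using P_mono by (metis P.scaleR)
    also have "\<dots> \<le> e k" by (rule e(2)) simp
    finally have "(1 / real n) *\<^sub>R (real n *\<^sub>R P ?d) \<le> (1 / real n) *\<^sub>R e k"
      by (intro scaleR_left_mono) simp_all
    then show ?thesis using n by simp
  qed
  have low: "(1 / real n) *\<^sub>R e (Suc k) \<le> P (?g k - ?g (Suc k))" for k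
  proof -
    let ?d = "?g k - ?g (Suc k)"
    have "e (Suc k) \<le> real n *\<^sub>R P ?d"
    proof (rule e(3))
      fix r :: real assume r: "0 \<le> r"
      \<comment> \<open>Taking \<open>?w\<close> for \<open>d\<close> turns \<open>d + h\<close>
        into \<open>n\<close> times \<open>z k\<close>, so a truncation at level
        \<open>Suc k\<close> is compared with slice \<open>k\<close>, and minimality of
        \<open>e (Suc k)\<close> applies.\<close>
      let ?w = "real n *\<^sub>R z (Suc k)"
      have "inf ((r / real n) *\<^sub>R pprt ?w) h + pprt ?w \<le> pprt (?w + h)"
        using r by (intro inf_scaleR_pprt_add_le) simp
      moreover have "?w + h = real n *\<^sub>R z k" using n by (simp add: z_Suc[of k] scaleR_add_right)
      ultimately have "inf (r *\<^sub>R ?g (Suc k)) h \<le> real n *\<^sub>R ?d"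
        using n by (simp add: pprt_scaleR scaleR_diff_right le_diff_eq)
      then show "P (inf (r *\<^sub>R ?g (Suc k)) h) \<le> real n *\<^sub>R P ?d"
        using P_mono by (metis P.scaleR)
    qed
    then have "(1 / real n) *\<^sub>R e (Suc k) \<le> (1 / real n) *\<^sub>R (real n *\<^sub>R P ?d)"
      by (intro scaleR_left_mono) simp_all
    then show ?thesis using n by simp
  qed
  show ?thesis
  proof (rule that[of e])
    show "x \<le> (1 / real n) *\<^sub>R (\<Sum>k<n. e k)"
      unfolding scaleR_sum_right by (subst tele) (intro sum_mono up)
    show "(1 / real n) *\<^sub>R (\<Sum>k<n. e (Suc k)) \<le> x"
      unfolding scaleR_sum_right by (subst tele) (intro sum_mono low)
  qed (rule e)
qed

text \<open>The spectral bounds are combinations of components, so \<open>A\<close> fixes them and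
  they trap \<open>A x\<close> together with \<open>x\<close>. Their difference telescopes to at
  most \<open>h / Suc n\<close>.\<close>

lemma eq_on_fixed_if_eq_on_components:
  assumes A: "linear A" "\<And>x. 0 \<le> x \<Longrightarrow> 0 \<le> A x"
    and id: "\<And>u. component u \<Longrightarrow> A u = u"
    and x: "P x = x" "0 \<le> x" "x \<le> h"
  shows "A x = x"
proof -
  interpret A: linear A by (rule A)
  have A_mono: "A a \<le> A b" if "a \<le> b" for a b using A(2)[of "b - a"] that by (simp add: A.diff)
  have "\<bar>A x - x\<bar> \<le> (1 / real (Suc n)) *\<^sub>R h" for n
  proof -
    obtain e where e: "\<And>k. component (e k)"
      and up: "x \<le> (1 / real (Suc n)) *\<^sub>R (\<Sum>k<Suc n. e k)"
      and low: "(1 / real (Suc n)) *\<^sub>R (\<Sum>k<Suc n. e (Suc k)) \<le> x"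
      using component_sandwich[OF x, of "Suc n"] by blast
    have AU: "A ((1 / real (Suc n)) *\<^sub>R (\<Sum>k<Suc n. e k)) = (1 / real (Suc n)) *\<^sub>R (\<Sum>k<Suc n. e k)"
      by (simp only: A.scale A.sum id[OF e])
    have AL: "A ((1 / real (Suc n)) *\<^sub>R (\<Sum>k<Suc n. e (Suc k)))
        = (1 / real (Suc n)) *\<^sub>R (\<Sum>k<Suc n. e (Suc k))"
      by (simp only: A.scale A.sum id[OF e])
    let ?U = "(1 / real (Suc n)) *\<^sub>R (\<Sum>k<Suc n. e k)"
      and ?L = "(1 / real (Suc n)) *\<^sub>R (\<Sum>k<Suc n. e (Suc k))"
    have "A x \<le> ?U" "?L \<le> A x" using A_mono[OF up] A_mono[OF low] AU AL by simp_all
    then have "A x - x \<le> ?U - ?L" "x - A x \<le> ?U - ?L" using up low by (auto intro: diff_mono)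
    then have "\<bar>A x - x\<bar> \<le> ?U - ?L" by (intro abs_leI) auto
    also have "\<dots> = (1 / real (Suc n)) *\<^sub>R (e 0 - e (Suc n))"
      by (simp only: sum_lessThan_telescope' flip: scaleR_diff_right sum_subtractf)
    also have "\<dots> \<le> (1 / real (Suc n)) *\<^sub>R (h - 0)"
      using e by (intro scaleR_left_mono diff_mono) (auto simp: component_def)
    finally show ?thesis by simp
  qed
  then have "\<bar>A x - x\<bar> \<le> 0" by (rule le_zero_if_le_inverse_scaleR)
  then show ?thesis by simp
qed

end

section \<open>Groups of positive operators\<close>

locale operator_group = lattice_projection P h for P :: "'e::banach_lattice \<Rightarrow> 'e" and h +
  fixes J :: "('e \<Rightarrow> 'e) set" and M :: real
  assumes P_in: "P \<in> J"
    and comp_in: "A \<in> J \<Longrightarrow> B \<in> J \<Longrightarrow> A \<circ> B \<in> J"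
    and commute: "A \<in> J \<Longrightarrow> B \<in> J \<Longrightarrow> A (B x) = B (A x)"
    and unit: "A \<in> J \<Longrightarrow> A (P x) = A x"
    and ex_inverse: "A \<in> J \<Longrightarrow> \<exists>B\<in>J. \<forall>x. B (A x) = P x"
    and linear_in: "A \<in> J \<Longrightarrow> linear A"
    and nonneg_in: "A \<in> J \<Longrightarrow> 0 \<le> x \<Longrightarrow> 0 \<le> A x"
    and norm_in: "A \<in> J \<Longrightarrow> norm (A x) \<le> M * norm x"
    and fix_h: "A \<in> J \<Longrightarrow> A h = h"
begin

lemma P_fix [simp]: "A \<in> J \<Longrightarrow> P (A x) = A x"
  using commute[OF P_in] unit by metis

lemma mono_in: "A \<in> J \<Longrightarrow> x \<le> y \<Longrightarrow> A x \<le> A y"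
  using nonneg_in[of A "y - x"] linear_in[of A] by (simp add: linear_diff)

text \<open>The inverse \<open>B\<close> of \<open>A\<close> maps
  \<open>meet (A u) (h - A u)\<close> below both \<open>u\<close> and \<open>h - u\<close>, hence to
  \<open>0\<close>; applying \<open>A\<close> recovers the meet.\<close>

lemma component_image:
  assumes A: "A \<in> J" and u: "component u"
  shows "component (A u)"
proof -
  obtain B where B: "B \<in> J" "\<And>x. B (A x) = P x" using ex_inverse[OF A] by blast
  have u': "P u = u" "0 \<le> u" "u \<le> h" "meet u (h - u) = 0"
    using u by (auto simp: component_def)
  have Au: "0 \<le> A u" "A u \<le> h"
    using nonneg_in[OF A u'(2)] mono_in[OF A u'(3)] fix_h[OF A] by auto
  let ?m = "meet (A u) (h - A u)"
  have "B ?m \<le> B (A u)" using A by (intro mono_in[OF B(1)] meet_le1) simp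
  moreover have "B ?m \<le> B (h - A u)"
    using A by (intro mono_in[OF B(1)] meet_le2) (simp add: P.diff P_h)
  ultimately have "B ?m \<le> u" "B ?m \<le> h - u"
    using B u' linear_diff[OF linear_in[OF B(1)]] fix_h[OF B(1)] by auto
  then have "B ?m \<le> meet u (h - u)" using B by (intro meet_greatest) auto
  moreover have "0 \<le> B ?m" using Au by (intro nonneg_in[OF B(1)] meet_nonneg) auto
  ultimately have "B ?m = 0" using u' by simp
  then have "A (B ?m) = 0" using linear_0[OF linear_in[OF A]] by simp
  then have "?m = 0" using commute[OF A B(1), of ?m] B(2)[of ?m] by simp
  then show ?thesis using A Au by (simp add: component_def)
qed

text \<open>Quantifying over all of \<open>J\<close> makes the relation invariant under the group,
  which need not act by isometries.\<close>

definition near :: "real \<Rightarrow> ('e \<times> 'e) set" where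
  "near \<delta> = {(u, v). component u \<and> component v \<and> (\<forall>A\<in>J. norm (A (u - v)) \<le> \<delta>)}"

lemma near_sym: "sym (near \<delta>)"
proof (rule symI)
  fix u v assume "(u, v) \<in> near \<delta>"
  moreover have "norm (A (v - u)) = norm (A (u - v))" if "A \<in> J" for A
    using linear_diff[OF linear_in[OF that]] by (simp add: norm_minus_commute)
  ultimately show "(v, u) \<in> near \<delta>" by (simp add: near_def)
qed

lemma near_image:
  assumes A: "A \<in> J" and "(u, v) \<in> (near \<delta>)\<^sup>*"
  shows "(A u, A v) \<in> (near \<delta>)\<^sup>*"
  using assms(2)
proof (induction rule: rtrancl_induct)
  case (step v w)
  then have vw: "component v" "component w" "\<And>B. B \<in> J \<Longrightarrow> norm (B (v - w)) \<le> \<delta>"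
    by (auto simp: near_def)
  have "norm (B (A v - A w)) \<le> \<delta>" if "B \<in> J" for B
    using vw(3)[OF comp_in[OF that A]] linear_diff[OF linear_in[OF A]] by simp
  then have "(A v, A w) \<in> near \<delta>"
    using component_image[OF A] vw by (simp add: near_def)
  then show ?case using step.IH by simp
qed simp

lemma near_subset: "near \<delta> \<subseteq> {(a, b). component a \<and> component b \<and> norm (a - b) \<le> \<delta>}"
proof -
  have "norm (u - v) \<le> \<delta>" if "(u, v) \<in> near \<delta>" for u v
  proof -
    have "P u = u" "P v = v" "norm (P (u - v)) \<le> \<delta>"
      using that P_in by (auto simp: near_def component_def)
    then show ?thesis by (simp add: P.diff)
  qed
  then show ?thesis by (auto simp: near_def)
qed

text \<open>The factor \<open>P\<close> covers \<open>n = 0\<close>, where the power is the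
  identity, which need not belong to \<open>J\<close>.\<close>

lemma funpow_comp_P_in: "V \<in> J \<Longrightarrow> (V ^^ n) \<circ> P \<in> J"
proof (induction n)
  case (Suc n)
  then have "V \<circ> ((V ^^ n) \<circ> P) \<in> J" by (intro comp_in[OF Suc.prems])
  then show ?case by (simp only: funpow.simps comp_assoc)
qed (simp add: P_in)

text \<open>Among the first \<open>card Z + 1\<close> iterates of \<open>u\<close>, two fall into
  one small ball; cancelling the smaller power by its inverse leaves \<open>l = j - i\<close>. The
  bound \<open>N\<close> is uniform in \<open>u\<close> and \<open>V\<close>, so that it can be
  fixed before a root \<open>V\<close> is chosen.\<close>

lemma ex_power_near:
  assumes "\<delta> > 0"
  obtains N where "\<And>u V. component u \<Longrightarrow> V \<in> J \<Longrightarrow> \<exists>l\<in>{1..N}. (u, (V ^^ l) u) \<in> (near \<delta>)\<^sup>*"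
proof -
  define \<rho> where "\<rho> = \<delta> / (2 * (\<bar>M\<bar> + 1))"
  have \<rho>: "\<rho> > 0" using assms by (simp add: \<rho>_def)
  obtain Z where Z: "finite Z" "{x. P x = x \<and> 0 \<le> x \<and> x \<le> h} \<subseteq> (\<Union>z\<in>Z. ball z \<rho>)"
    using compact_fixed[unfolded compact_eq_totally_bounded] \<rho> by blast
  have "\<exists>l\<in>{1..card Z}. (u, (V ^^ l) u) \<in> (near \<delta>)\<^sup>*" if u: "component u" and V: "V \<in> J" for u V
  proof -
    have Pu: "P u = u" using u by (simp add: component_def)
    have comp: "component ((V ^^ i) u)" for i
      using component_image[OF funpow_comp_P_in[OF V] u, of i] by (simp add: Pu)
    have "\<exists>z\<in>Z. (V ^^ i) u \<in> ball z \<rho>" for i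
      using subsetD[OF Z(2), of "(V ^^ i) u"] comp[of i] by (simp add: component_def)
    then obtain z where z: "\<And>i. z i \<in> Z" "\<And>i. (V ^^ i) u \<in> ball (z i) \<rho>" by metis
    have "\<not> inj_on z {0..card Z}"
    proof
      assume "inj_on z {0..card Z}"
      then have "card {0..card Z} \<le> card Z" using z(1) Z(1) by (intro card_inj_on_le[of z]) auto
      then show False by simp
    qed
    then obtain i j where ij: "i < j" "j \<le> card Z" "z i = z j"
      unfolding inj_on_def by (metis atLeastAtMost_iff linorder_neqE_nat)
    have "dist ((V ^^ i) u) ((V ^^ j) u) < 2 * \<rho>"
      using z(2)[of i] z(2)[of j] ij(3) dist_triangle_less_add[of "(V ^^ i) u" "z i" \<rho> "(V ^^ j) u" \<rho>]
      by (simp add: dist_commute)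
    then have d: "norm ((V ^^ i) u - (V ^^ j) u) \<le> 2 * \<rho>" by (simp add: dist_norm)
    have "norm (A ((V ^^ i) u - (V ^^ j) u)) \<le> \<delta>" if A: "A \<in> J" for A
    proof -
      have "norm (A ((V ^^ i) u - (V ^^ j) u)) \<le> M * norm ((V ^^ i) u - (V ^^ j) u)"
        by (rule norm_in[OF A])
      also have "\<dots> \<le> (\<bar>M\<bar> + 1) * (2 * \<rho>)" using d by (intro mult_mono) auto
      also have "\<dots> = \<delta>" by (simp add: \<rho>_def divide_simps)
      finally show ?thesis .
    qed
    then have ij_near: "((V ^^ i) u, (V ^^ j) u) \<in> (near \<delta>)\<^sup>*" using comp by (auto simp: near_def)
    obtain W where W: "W \<in> J" "\<And>x. W (((V ^^ i) \<circ> P) x) = P x"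
      using ex_inverse[OF funpow_comp_P_in[OF V]] by blast
    have "(W ((V ^^ i) u), W ((V ^^ j) u)) \<in> (near \<delta>)\<^sup>*" by (rule near_image[OF W(1) ij_near])
    moreover have "W ((V ^^ i) u) = u" using W(2)[of u] by (simp add: Pu)
    moreover have "W ((V ^^ j) u) = (V ^^ (j - i)) u"
    proof -
      have "(V ^^ j) u = (V ^^ i) ((V ^^ (j - i)) u)"
        using ij(1) by (metis comp_apply funpow_add le_add_diff_inverse less_imp_le)
      moreover have "P ((V ^^ (j - i)) u) = (V ^^ (j - i)) u" using comp by (simp add: component_def)
      ultimately show ?thesis using W(2)[of "(V ^^ (j - i)) u"] by simp
    qed
    ultimately have "(u, (V ^^ (j - i)) u) \<in> (near \<delta>)\<^sup>*" by simp
    then show ?thesis using ij by (intro bexI[of _ "j - i"]) auto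
  qed
  then show ?thesis using that by blast
qed

lemma near_funpow_mult:
  assumes V: "V \<in> J" and u: "component u" and "(u, (V ^^ l) u) \<in> (near \<delta>)\<^sup>*"
  shows "(u, (V ^^ (l * m)) u) \<in> (near \<delta>)\<^sup>*"
proof (induction m)
  case (Suc m)
  have Pu: "P u = u" using u by (simp add: component_def)
  have PV: "P ((V ^^ k) u) = (V ^^ k) u" for k
    using P_fix[OF funpow_comp_P_in[OF V, of k], of u] by (simp add: Pu)
  have "((V ^^ (l * m)) u, (V ^^ (l * m)) ((V ^^ l) u)) \<in> (near \<delta>)\<^sup>*"
    using near_image[OF funpow_comp_P_in[OF V, of "l * m"] assms(3)] by (simp add: Pu PV)
  also have "(V ^^ (l * m)) ((V ^^ l) u) = (V ^^ (l * Suc m)) u"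
    by (simp add: funpow_add add.commute[of l])
  finally show ?case using Suc by (meson rtrancl_trans)
qed simp

text \<open>With \<open>N\<close> from \<open>ex_power_near\<close> and \<open>V\<close> a root of \<open>A\<close> of order \<open>N!\<close>, some \<open>V\<^sup>l\<close> with \<open>l \<le> N\<close> keeps \<open>u\<close>
  in its chain class; since \<open>l\<close> divides \<open>N!\<close>, so does \<open>A\<close>.\<close>

lemma divisible_eq_id:
  assumes A: "A \<in> J"
    and roots: "\<And>n. n \<ge> 1 \<Longrightarrow> \<exists>V\<in>J. \<forall>x. P x = x \<longrightarrow> (V ^^ n) x = A x"
    and x: "P x = x" "0 \<le> x" "x \<le> h"
  shows "A x = x"
proof (rule eq_on_fixed_if_eq_on_components[OF linear_in[OF A] nonneg_in[OF A] _ x])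
  fix u assume u: "component u"
  have near: "(u, A u) \<in> (near \<delta>)\<^sup>*" if \<delta>: "\<delta> > 0" for \<delta>
  proof -
    obtain N where N: "\<And>u V. component u \<Longrightarrow> V \<in> J \<Longrightarrow> \<exists>l\<in>{1..N}. (u, (V ^^ l) u) \<in> (near \<delta>)\<^sup>*"
      using ex_power_near[OF \<delta>] by blast
    obtain V where V: "V \<in> J" "\<And>x. P x = x \<Longrightarrow> (V ^^ fact N) x = A x"
      using roots[of "fact N"] by (metis fact_ge_1)
    obtain l where l: "l \<in> {1..N}" "(u, (V ^^ l) u) \<in> (near \<delta>)\<^sup>*" using N[OF u V(1)] by blast
    have "l dvd fact N" using l(1) by (intro dvd_fact) auto
    then obtain m where "fact N = l * m" by (elim dvdE)
    then have "(u, (V ^^ fact N) u) \<in> (near \<delta>)\<^sup>*" using near_funpow_mult[OF V(1) u l(2), of m] by metis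
    then show ?thesis using V(2)[of u] u by (simp add: component_def)
  qed
  have near': "(A u, u) \<in> (near \<delta>)\<^sup>*" if "\<delta> > 0" for \<delta>
    by (rule symD[OF sym_rtrancl[OF near_sym] near[OF that]])
  show "A u = u"
  proof (rule antisym)
    show "A u \<le> u"
      by (rule component_le_of_chains[OF component_image[OF A u] u])
        (rule subsetD[OF rtrancl_mono[OF near_subset] near'])
    show "u \<le> A u"
      by (rule component_le_of_chains[OF u component_image[OF A u]])
        (rule subsetD[OF rtrancl_mono[OF near_subset] near])
  qed
qed

end

section \<open>Compact semigroups of operators\<close>

lemma continuous_on_eval: "continuous_on S (\<lambda>A :: 'a \<Rightarrow> 'b::topological_space. A x)"
  by (rule continuous_on_product_then_coordinatewise) (rule continuous_on_id)

text \<open>The topology is that of pointwise convergence, which need not be metrizable; closedness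
  comes from the Hausdorff property of the product.\<close>

lemma compact_imp_closed_fun:
  fixes S :: "('a \<Rightarrow> 'b::metric_space) set"
  assumes "compact S"
  shows "closed S"
proof -
  have "Hausdorff_space (product_topology (\<lambda>_::'a. euclidean :: 'b topology) UNIV)"
    by (simp add: Hausdorff_space_product_topology)
  then have "Hausdorff_space (euclidean :: ('a \<Rightarrow> 'b) topology)"
    by (simp add: euclidean_product_topology)
  then show ?thesis using assms compactin_imp_closedin[of euclidean S] by simp
qed

text \<open>Tychonoff: the closure is a closed subset of the product of the compact orbit
  closures.\<close>

lemma compact_closure_fun:
  fixes B :: "('a \<Rightarrow> 'b::metric_space) set"
  assumes "\<And>x. compact (closure ((\<lambda>A. A x) ` B))"
  shows "compact (closure B)"
proof -
  let ?K = "\<lambda>x. closure ((\<lambda>A. A x) ` B)"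
  have "compactin (product_topology (\<lambda>_::'a. euclidean :: 'b topology) UNIV) (PiE UNIV ?K)"
    using assms by (simp add: compactin_PiE)
  then have "compact (PiE UNIV ?K)" by (simp add: euclidean_product_topology)
  moreover have "closure B \<subseteq> PiE UNIV ?K"
  proof -
    have "closed ((\<lambda>A. A x) -` ?K x)" for x
      by (intro closed_vimage closed_closure continuous_on_eval)
    then have "closure B \<subseteq> (\<lambda>A. A x) -` ?K x" for x
      using closure_subset[of "(\<lambda>A. A x) ` B"] by (intro closure_minimal) auto
    then show ?thesis by (auto simp: PiE_def)
  qed
  ultimately show ?thesis by (metis closed_closure compact_Int_closed inf.absorb2)
qed

locale compact_operator_semigroup =
  fixes \<Sigma> :: "('e::real_normed_vector \<Rightarrow> 'e) set"
  assumes compact: "compact \<Sigma>"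
    and nonempty: "\<Sigma> \<noteq> {}"
    and comp_in: "A \<in> \<Sigma> \<Longrightarrow> B \<in> \<Sigma> \<Longrightarrow> A \<circ> B \<in> \<Sigma>"
    and comm: "A \<in> \<Sigma> \<Longrightarrow> B \<in> \<Sigma> \<Longrightarrow> A \<circ> B = B \<circ> A"
    and continuous: "A \<in> \<Sigma> \<Longrightarrow> continuous_on UNIV A"
begin

text \<open>The smallest ideal, which is a group (Jacobs, de Leeuw, Glicksberg).\<close>

definition kernel :: "('e \<Rightarrow> 'e) set" where
  "kernel = (\<Inter>A\<in>\<Sigma>. (\<circ>) A ` \<Sigma>)"

lemma kernel_subset: "kernel \<subseteq> \<Sigma>"
  using nonempty comp_in by (auto simp: kernel_def)

text \<open>Finite intersection property: by commutativity, a product of finitely many members of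
  \<open>\<Sigma>\<close> lies in the translate of \<open>\<Sigma>\<close> by each factor, and these
  translates are compact, hence closed.\<close>

lemma kernel_nonempty: "kernel \<noteq> {}"
proof -
  have closed: "closed ((\<circ>) A ` \<Sigma>)" if A: "A \<in> \<Sigma>" for A
  proof (rule compact_imp_closed_fun[OF compact_continuous_image[OF _ compact]])
    show "continuous_on \<Sigma> ((\<circ>) A)"
    proof (rule continuous_on_coordinatewise_then_product)
      fix x
      show "continuous_on \<Sigma> (\<lambda>B. (A \<circ> B) x)"
        unfolding comp_apply
        by (rule continuous_on_compose2[OF continuous[OF A] continuous_on_eval]) auto
    qed
  qed
  have fip: "\<exists>C\<in>\<Sigma>. \<forall>A\<in>F. C \<in> (\<circ>) A ` \<Sigma>" if "finite F" "F \<subseteq> \<Sigma>" for F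
    using that
  proof (induction F rule: finite_induct)
    case empty
    then show ?case using nonempty by auto
  next
    case (insert A F)
    then obtain C where C: "C \<in> \<Sigma>" "\<And>A. A \<in> F \<Longrightarrow> C \<in> (\<circ>) A ` \<Sigma>" by blast
    have "A \<circ> C \<in> (\<circ>) A' ` \<Sigma>" if A': "A' \<in> F" for A'
    proof -
      obtain D where D: "D \<in> \<Sigma>" "C = A' \<circ> D" using C(2)[OF A'] by auto
      then have "A \<circ> C = A' \<circ> (A \<circ> D)"
        using comm[of A A'] insert.prems A' by (metis comp_assoc insert_subset subsetD)
      then show ?thesis using comp_in[of A D] insert.prems D by auto
    qed
    moreover have "A \<circ> C \<in> (\<circ>) A ` \<Sigma>" using C(1) by (rule imageI)
    moreover have "A \<circ> C \<in> \<Sigma>" using C(1) insert.prems by (intro comp_in) auto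
    ultimately show ?case by blast
  qed
  have "\<Sigma> \<inter> (\<Inter>A\<in>\<Sigma>. (\<circ>) A ` \<Sigma>) \<noteq> {}"
  proof (rule compact_imp_fip_image[OF compact])
    show "\<Sigma> \<inter> (\<Inter>A\<in>F. (\<circ>) A ` \<Sigma>) \<noteq> {}" if "finite F" "F \<subseteq> \<Sigma>" for F
      using fip[OF that] by blast
  qed (use closed in auto)
  then show ?thesis by (auto simp: kernel_def)
qed

lemma kernel_ideal:
  assumes "j \<in> kernel" "A \<in> \<Sigma>"
  shows "A \<circ> j \<in> kernel"
  unfolding kernel_def
proof
  fix B assume B: "B \<in> \<Sigma>"
  then obtain C where C: "C \<in> \<Sigma>" "j = B \<circ> C" using assms(1) by (auto simp: kernel_def)
  have "A \<circ> j = B \<circ> (A \<circ> C)" using C comm[OF assms(2) B] by (metis comp_assoc)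
  then show "A \<circ> j \<in> (\<circ>) B ` \<Sigma>" using comp_in[OF assms(2) C(1)] by auto
qed

text \<open>Every kernel element is a multiple of every element of \<open>\<Sigma>\<close>. Dividing
  \<open>j\<close> by \<open>j \<circ> j\<close> yields \<open>P\<close> with
  \<open>P \<circ> j = j\<close>; it is neutral on all multiples of \<open>j\<close>, hence on the
  kernel.\<close>

lemma kernel_group:
  obtains P where "P \<in> kernel" "\<And>A. A \<in> kernel \<Longrightarrow> A \<circ> P = A"
    "\<And>A. A \<in> kernel \<Longrightarrow> \<exists>B\<in>kernel. B \<circ> A = P"
proof -
  obtain j where j: "j \<in> kernel" using kernel_nonempty by auto
  have j\<Sigma>: "j \<in> \<Sigma>" using j kernel_subset by auto
  have div: "\<exists>C\<in>\<Sigma>. A = C \<circ> B" if "A \<in> kernel" "B \<in> \<Sigma>" for A B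
    using that comm[OF that(2)] by (force simp: kernel_def)
  obtain P0 where P0: "P0 \<in> \<Sigma>" "j = P0 \<circ> (j \<circ> j)" using div[OF j comp_in[OF j\<Sigma> j\<Sigma>]] by auto
  define P where "P = P0 \<circ> j"
  have P: "P \<in> kernel" unfolding P_def by (rule kernel_ideal[OF j P0(1)])
  then have P\<Sigma>: "P \<in> \<Sigma>" using kernel_subset by auto
  have Pj: "P \<circ> j = j" using P0(2) by (simp add: P_def comp_assoc)
  have unit: "A \<circ> P = A" if A: "A \<in> kernel" for A
  proof -
    obtain C where C: "C \<in> \<Sigma>" "A = C \<circ> j" using div[OF A j\<Sigma>] by auto
    then have "A \<circ> P = C \<circ> (P \<circ> j)" using comm[OF j\<Sigma> P\<Sigma>] by (simp add: comp_assoc)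
    then show ?thesis using C Pj by simp
  qed
  moreover have "\<exists>B\<in>kernel. B \<circ> A = P" if A: "A \<in> kernel" for A
  proof -
    have A\<Sigma>: "A \<in> \<Sigma>" using A kernel_subset by auto
    obtain C where C: "C \<in> \<Sigma>" "P = C \<circ> A" using div[OF P A\<Sigma>] by auto
    have "(C \<circ> P) \<circ> A = C \<circ> (A \<circ> P)" using comm[OF P\<Sigma> A\<Sigma>] by (simp add: comp_assoc)
    also have "\<dots> = P" using unit[OF A] C by simp
    finally show ?thesis using kernel_ideal[OF P C(1)] by auto
  qed
  ultimately show ?thesis using that P by blast
qed

end

text \<open>Template for passing closed conditions to the pointwise closure. The index
  \<open>x\<close> may have any type, for instance pairs of vectors.\<close>

lemma closure_fun_subset:
  assumes "B \<subseteq> {A. \<forall>x. f x A \<in> K x}" "\<And>x. closed (K x)" "\<And>x. continuous_on UNIV (f x)"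
  shows "closure B \<subseteq> {A. \<forall>x. f x A \<in> K x}"
proof (rule closure_minimal[OF assms(1)])
  have "{A. \<forall>x. f x A \<in> K x} = (\<Inter>x. f x -` K x)" by auto
  moreover have "closed \<dots>" using assms(2,3) by (intro closed_INT ballI closed_vimage) auto
  ultimately show "closed {A. \<forall>x. f x A \<in> K x}" by simp
qed

lemma closure_operators:
  fixes B :: "('e::banach_lattice \<Rightarrow> 'e) set"
  assumes B: "\<And>A. A \<in> B \<Longrightarrow> linear A" "\<And>A x. A \<in> B \<Longrightarrow> 0 \<le> x \<Longrightarrow> 0 \<le> A x"
      "\<And>A x. A \<in> B \<Longrightarrow> norm (A x) \<le> M * norm x" "\<And>A. A \<in> B \<Longrightarrow> A h = h"
    and A: "A \<in> closure B"
  shows "linear A" "0 \<le> x \<Longrightarrow> 0 \<le> A x" "norm (A x) \<le> M * norm x" "A h = h"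
proof -
  have "A \<in> {A. \<forall>p. A (fst p + snd p) - A (fst p) - A (snd p) \<in> {0}}"
    by (rule subsetD[OF closure_fun_subset A])
      (use B(1) in \<open>auto simp: linear_add intro!: continuous_intros continuous_on_eval\<close>)
  moreover have "A \<in> {A. \<forall>p. A (fst p *\<^sub>R snd p) - fst p *\<^sub>R A (snd p) \<in> {0}}"
    by (rule subsetD[OF closure_fun_subset A])
      (use B(1) in \<open>auto simp: linear_cmul intro!: continuous_intros continuous_on_eval\<close>)
  ultimately show "linear A" by (intro linearI) (auto simp: algebra_simps)
  \<comment> \<open>\<open>pprt x\<close> runs through all positive vectors, which makes positivity
    a condition on every \<open>x\<close>.\<close>
  have "A \<in> {A. \<forall>x. A (pprt x) \<in> {y. 0 \<le> y}}"
    by (rule subsetD[OF closure_fun_subset A])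
      (use B(2) closed_nonneg_lattice in \<open>auto intro!: continuous_on_eval\<close>)
  then show "0 \<le> A x" if "0 \<le> x" using that pprt_eq_id[OF that] by (auto dest: spec[of _ x])
  have "A \<in> {A. \<forall>x. A x \<in> cball 0 (M * norm x)}"
    by (rule subsetD[OF closure_fun_subset A]) (use B(3) in \<open>auto intro!: continuous_on_eval\<close>)
  then show "norm (A x) \<le> M * norm x" by simp
  \<comment> \<open>A single condition, indexed by the one-element type to fit the template.\<close>
  have "A \<in> {A. \<forall>x::unit. A h \<in> {h}}"
    by (rule subsetD[OF closure_fun_subset A]) (use B(4) in \<open>auto intro!: continuous_on_eval\<close>)
  then show "A h = h" by simp
qed

text \<open>Composition is continuous in the outer operator, and in the inner one when the outer is
  continuous. So the closure is taken in one factor at a time: first in the inner, then in the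
  outer.\<close>

lemma compact_operator_semigroup_closure:
  fixes B :: "('e::real_normed_vector \<Rightarrow> 'e) set"
  assumes compact: "\<And>x. compact (closure ((\<lambda>A. A x) ` B))"
    and nonempty: "B \<noteq> {}"
    and comp: "\<And>A C. A \<in> B \<Longrightarrow> C \<in> B \<Longrightarrow> A \<circ> C \<in> B"
    and comm: "\<And>A C. A \<in> B \<Longrightarrow> C \<in> B \<Longrightarrow> A \<circ> C = C \<circ> A"
    and cont: "\<And>A. A \<in> closure B \<Longrightarrow> continuous_on UNIV A"
  shows "compact_operator_semigroup (closure B)"
proof
  have contB: "continuous_on UNIV A" if "A \<in> B" for A
    using cont that closure_subset by blast
  have contl: "continuous_on UNIV (\<lambda>C x. A (C x))" if "continuous_on UNIV A" for A :: "'e \<Rightarrow> 'e"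
    by (intro continuous_on_coordinatewise_then_product
        continuous_on_compose2[OF that continuous_on_eval]) auto
  have contr: "continuous_on UNIV (\<lambda>C x. C (A x))" for A :: "'e \<Rightarrow> 'e"
    by (intro continuous_on_coordinatewise_then_product continuous_on_eval)
  have 1: "closure B \<subseteq> (\<lambda>C x. A (C x)) -` closure B" if "A \<in> B" for A
    using comp[OF that] closure_subset[of B]
    by (intro closure_minimal closed_vimage contl contB[OF that]) (auto simp: comp_def)
  have 2: "closure B \<subseteq> (\<lambda>A x. A (C x)) -` closure B" if "C \<in> closure B" for C
    using 1 that by (intro closure_minimal closed_vimage contr) auto
  show "A \<circ> C \<in> closure B" if "A \<in> closure B" "C \<in> closure B" for A C
    using 2[OF that(2)] that(1) by (auto simp: comp_def)
  have 3: "closure B \<subseteq> {C. \<forall>x. A (C x) - C (A x) \<in> {0}}" if "A \<in> B" for A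
    using comm[OF that] continuous_on_compose2[OF contB[OF that] continuous_on_eval]
    by (intro closure_fun_subset) (auto simp: fun_eq_iff intro!: continuous_intros continuous_on_eval)
  have 4: "closure B \<subseteq> {A. \<forall>x. A (C x) - C (A x) \<in> {0}}" if "C \<in> closure B" for C
    using 3 that continuous_on_compose2[OF cont[OF that] continuous_on_eval]
    by (intro closure_fun_subset) (auto intro!: continuous_intros continuous_on_eval)
  show "A \<circ> C = C \<circ> A" if "A \<in> closure B" "C \<in> closure B" for A C
    using 4[OF that(2)] that(1) by (auto simp: fun_eq_iff)
qed (use compact nonempty cont in \<open>auto intro: compact_closure_fun\<close>)

section \<open>Convergence\<close>

text \<open>A finite net for the approximating family is one for \<open>f\<close> at a larger
  radius. Closed balls of radius \<open>e / 2\<close> survive taking the closure and fit into open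
  balls of radius \<open>e\<close>.\<close>

lemma compact_closure_if_approximable:
  fixes f :: "'i \<Rightarrow> 'a::banach"
  assumes "\<And>e. e > 0 \<Longrightarrow> \<exists>g. compact (closure (g ` I)) \<and> (\<forall>i\<in>I. dist (f i) (g i) \<le> e)"
  shows "compact (closure (f ` I))"
  unfolding compact_eq_totally_bounded
proof (intro conjI allI impI)
  show "complete (closure (f ` I))" by (simp add: complete_eq_closed)
  fix e :: real assume e: "e > 0"
  obtain g where g: "compact (closure (g ` I))" "\<And>i. i \<in> I \<Longrightarrow> dist (f i) (g i) \<le> e / 4"
    using assms[of "e / 4"] e by auto
  obtain Z where Z: "finite Z" "closure (g ` I) \<subseteq> (\<Union>z\<in>Z. ball z (e / 4))"
    using g(1)[unfolded compact_eq_totally_bounded] e by (meson zero_less_divide_iff zero_less_numeral)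
  have "f ` I \<subseteq> (\<Union>z\<in>Z. cball z (e / 2))"
  proof
    fix y assume "y \<in> f ` I"
    then obtain i where i: "i \<in> I" "y = f i" by auto
    then have "g i \<in> (\<Union>z\<in>Z. ball z (e / 4))" using Z(2) closure_subset[of "g ` I"] by blast
    then obtain z where z: "z \<in> Z" "dist z (g i) < e / 4" by auto
    have "dist z (f i) \<le> dist z (g i) + dist (f i) (g i)" by (rule dist_triangle2)
    also have "\<dots> \<le> e / 4 + e / 4" using z(2) g(2)[OF i(1)] by (intro add_mono) auto
    finally show "y \<in> (\<Union>z\<in>Z. cball z (e / 2))" using z(1) i(2) by auto
  qed
  then have "closure (f ` I) \<subseteq> (\<Union>z\<in>Z. cball z (e / 2))"
    using Z(1) by (intro closure_minimal closed_UN) auto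
  also have "\<dots> \<subseteq> (\<Union>z\<in>Z. ball z e)" using e by force
  finally show "\<exists>k. finite k \<and> closure (f ` I) \<subseteq> (\<Union>x\<in>k. ball x e)" using Z(1) by blast
qed

text \<open>Differences of elements of \<open>S\<close> are closed under subtraction; adding and
  subtracting \<open>s0\<close> writes \<open>0\<close> and the elements of \<open>S\<close> as such
  differences.\<close>

lemma group_closure_subsemigroup:
  assumes S: "subsemigroup S" "s0 \<in> S" and x: "x \<in> group_closure S"
  obtains a b where "a \<in> S" "b \<in> S" "x = a - b"
proof -
  have "\<exists>a\<in>S. \<exists>b\<in>S. x = a - b"
    using x
  proof (induction rule: group_closure.induct)
    case (base x)
    then show ?case
    proof
      assume "x = 0"
      then show ?thesis using S(2) by force
    next
      assume "x \<in> S"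
      then have "x + s0 \<in> S" using S by (auto simp: subsemigroup_def)
      then show ?thesis using S(2) by force
    qed
  next
    case (diff x y)
    then obtain a b c d where abcd: "a \<in> S" "b \<in> S" "c \<in> S" "d \<in> S" "x = a - b" "y = c - d"
      by auto
    then have "a + d \<in> S" "b + c \<in> S" using S(1) by (auto simp: subsemigroup_def)
    moreover have "x - y = (a + d) - (b + c)" using abcd by simp
    ultimately show ?case by blast
  qed
  then show ?thesis using that by blast
qed

text \<open>Stated for \<open>Suc n\<close>, since the empty sum \<open>0\<close> need not belong to
  \<open>S\<close>.\<close>

lemma sum_const_in_subsemigroup:
  assumes "subsemigroup S" "b \<in> S"
  shows "(\<Sum>i<Suc n. b) \<in> S"
  by (induction n) (use assms in \<open>auto simp: subsemigroup_def\<close>)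

section \<open>The representation and the closure of its operators\<close>

locale AM_compact_representation =
  fixes S :: "'g::ab_group_add set" and T :: "'g \<Rightarrow> 'e::banach_lattice \<Rightarrow>\<^sub>L 'e"
    and M :: real and h :: 'e and s0 :: 'g
  assumes subsemigroup: "subsemigroup S"
    and divisible: "divisible (group_closure S)"
    and T_add: "s \<in> S \<Longrightarrow> t \<in> S \<Longrightarrow> T (s + t) x = T s (T t x)"
    and T_nonneg: "t \<in> S \<Longrightarrow> 0 \<le> x \<Longrightarrow> 0 \<le> T t x"
    and norm_T: "t \<in> S \<Longrightarrow> norm (T t) \<le> M"
    and s0: "s0 \<in> S" "AM_compact (T s0)"
    and T_h: "t \<in> S \<Longrightarrow> T t h = h"
    and h: "quasi_interior h"
begin

lemma add_in: "s \<in> S \<Longrightarrow> t \<in> S \<Longrightarrow> s + t \<in> S"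
  using subsemigroup by (auto simp: subsemigroup_def)

lemma norm_T_apply: "t \<in> S \<Longrightarrow> norm (T t x) \<le> M * norm x"
  using norm_blinfun[of "T t" x] norm_T[of t] mult_right_mono[of "norm (T t)" M "norm x"] by simp

lemma M_nonneg: "0 \<le> M"
  using norm_T[OF s0(1)] norm_ge_zero[of "T s0"] by linarith

lemma T_mono: "t \<in> S \<Longrightarrow> x \<le> y \<Longrightarrow> T t x \<le> T t y"
  using T_nonneg[of t "y - x"] by (simp add: blinfun.diff_right)

lemma T_interval:
  assumes "t \<in> S" "x \<in> {- c *\<^sub>R h..c *\<^sub>R h}"
  shows "T t x \<in> {- c *\<^sub>R h..c *\<^sub>R h}"
  using assms T_mono[OF assms(1), of x "c *\<^sub>R h"] T_mono[OF assms(1), of "- c *\<^sub>R h" x]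
  by (simp add: blinfun.scaleR_right blinfun.minus_right T_h)

text \<open>Parameters of the form \<open>s0 + t\<close> make every operator factor through the
  AM-compact \<open>T s0\<close>.\<close>

definition orbit_ops :: "('e \<Rightarrow> 'e) set" where
  "orbit_ops = (\<lambda>t. blinfun_apply (T (s0 + t))) ` S"

lemma orbit_ops_apply: "t \<in> S \<Longrightarrow> T (s0 + t) x = T s0 (T t x)"
  by (rule T_add[OF s0(1)])

text \<open>For \<open>y\<close> in the principal ideal of \<open>h\<close> the orbit stays in an
  order interval, which \<open>T s0\<close> maps into a compact set. Density of the ideal and the
  uniform bound \<open>M\<close> extend this to every \<open>x\<close>.\<close>

lemma orbit_compact: "compact (closure ((\<lambda>A. A x) ` orbit_ops))"
proof -
  have "compact (closure ((\<lambda>t. T (s0 + t) x) ` S))"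
  proof (rule compact_closure_if_approximable)
    fix e :: real assume e: "e > 0"
    have "x \<in> closure (principal_ideal h)" using h by (simp add: quasi_interior_def)
    then obtain y where y: "y \<in> principal_ideal h" "dist y x < e / (M + 1)"
      using e M_nonneg by (metis closure_approachable add_nonneg_pos divide_pos_pos zero_less_one)
    then obtain c where c: "\<bar>y\<bar> \<le> c *\<^sub>R h" by (auto simp: principal_ideal_def)
    have "y \<in> {- c *\<^sub>R h..c *\<^sub>R h}" using c by (auto simp: abs_le_iff minus_le_iff)
    then have "(\<lambda>t. T (s0 + t) y) ` S \<subseteq> T s0 ` {- c *\<^sub>R h..c *\<^sub>R h}"
      using orbit_ops_apply T_interval by auto
    then have "closure ((\<lambda>t. T (s0 + t) y) ` S) \<subseteq> closure (T s0 ` {- c *\<^sub>R h..c *\<^sub>R h})"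
      by (rule closure_mono)
    moreover have "compact (closure (T s0 ` {- c *\<^sub>R h..c *\<^sub>R h}))"
      using s0(2) by (simp add: AM_compact_def)
    ultimately have "compact (closure ((\<lambda>t. T (s0 + t) y) ` S))"
      by (metis closed_closure compact_Int_closed inf.absorb2)
    moreover have "dist (T (s0 + t) x) (T (s0 + t) y) \<le> e" if t: "t \<in> S" for t
    proof -
      have "norm (T (s0 + t) (x - y)) \<le> M * norm (x - y)"
        by (intro norm_T_apply add_in s0 t)
      also have "\<dots> \<le> (M + 1) * (e / (M + 1))"
        using y(2) M_nonneg by (intro mult_mono) (auto simp: dist_norm norm_minus_commute)
      also have "\<dots> = e" using M_nonneg by simp
      finally show ?thesis by (simp add: dist_norm blinfun.diff_right)
    qed
    ultimately show "\<exists>g. compact (closure (g ` S)) \<and> (\<forall>t\<in>S. dist (T (s0 + t) x) (g t) \<le> e)"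
      by blast
  qed
  then show ?thesis by (simp add: orbit_ops_def image_image)
qed

lemma orbit_ops_props:
  assumes "A \<in> orbit_ops"
  shows "linear A" "0 \<le> x \<Longrightarrow> 0 \<le> A x" "norm (A x) \<le> M * norm x" "A h = h"
proof -
  obtain t where t: "s0 + t \<in> S" "A = T (s0 + t)"
    using assms add_in[OF s0(1)] by (auto simp: orbit_ops_def)
  then show "linear A" "0 \<le> x \<Longrightarrow> 0 \<le> A x" "norm (A x) \<le> M * norm x" "A h = h"
    using T_nonneg norm_T_apply T_h by (simp_all add: bounded_linear.linear[OF blinfun.bounded_linear_right])
qed

lemma closure_props:
  assumes "A \<in> closure orbit_ops"
  shows "linear A" "0 \<le> x \<Longrightarrow> 0 \<le> A x" "norm (A x) \<le> M * norm x" "A h = h"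
  using closure_operators[where B = orbit_ops and M = M and h = h and A = A,
      OF _ _ _ _ assms] orbit_ops_props by blast+

lemma bounded_linear_closure: "A \<in> closure orbit_ops \<Longrightarrow> bounded_linear A"
  using closure_props(1,3)[of A]
  by (intro bounded_linear.intro bounded_linear_axioms.intro) (auto simp: mult.commute)

sublocale J: compact_operator_semigroup "closure orbit_ops"
proof (rule compact_operator_semigroup_closure[OF orbit_compact])
  show "orbit_ops \<noteq> {}" using s0 by (auto simp: orbit_ops_def)
  show "continuous_on UNIV A" if "A \<in> closure orbit_ops" for A
    using bounded_linear_closure[OF that] by (rule linear_continuous_on)
  fix A C assume "A \<in> orbit_ops" "C \<in> orbit_ops"
  then obtain s t where st: "s \<in> S" "t \<in> S" "A = T (s0 + s)" "C = T (s0 + t)"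
    by (auto simp: orbit_ops_def)
  have in_S: "s0 + s \<in> S" "s0 + t \<in> S" using st s0 add_in by auto
  have AC: "A \<circ> C = T (s0 + s + (s0 + t))" "C \<circ> A = T (s0 + t + (s0 + s))"
    unfolding st comp_def using T_add in_S by (simp_all add: fun_eq_iff)
  then show "A \<circ> C = C \<circ> A" by (simp add: add.commute)
  have "s + (s0 + t) \<in> S" using st in_S add_in by auto
  then show "A \<circ> C \<in> orbit_ops"
    using AC(1) by (auto simp: orbit_ops_def add.assoc)
qed

text \<open>\<open>T t\<close> itself need not lie in the closure, but composing with it only shifts
  the parameter: \<open>t + (s0 + s) = s0 + (t + s)\<close>.\<close>

lemma T_comp_closure:
  assumes t: "t \<in> S" and A: "A \<in> closure orbit_ops"
  shows "T t \<circ> A \<in> closure orbit_ops"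
proof -
  have "continuous_on UNIV (\<lambda>C x. T t (C x))"
    by (intro continuous_on_coordinatewise_then_product continuous_intros continuous_on_eval)
  moreover have "(\<lambda>x. T t (C x)) \<in> orbit_ops" if C: "C \<in> orbit_ops" for C
  proof -
    obtain s where s: "s \<in> S" "C = T (s0 + s)" using C by (auto simp: orbit_ops_def)
    have "T t (C x) = T (s0 + (t + s)) x" for x
      using T_add[OF t add_in[OF s0(1) s(1)], of x] s(2) by (simp add: ac_simps)
    then show ?thesis using add_in[OF t s(1)] by (auto simp: orbit_ops_def)
  qed
  ultimately have "closure orbit_ops \<subseteq> (\<lambda>C x. T t (C x)) -` closure orbit_ops"
    using closure_subset[of orbit_ops] by (intro closure_minimal closed_vimage) auto
  then show ?thesis using A by (auto simp: comp_def)
qed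

lemma T_commute_closure:
  assumes t: "t \<in> S" and A: "A \<in> closure orbit_ops"
  shows "T t (A x) = A (T t x)"
proof -
  have "A \<in> {A. \<forall>x. T t (A x) - A (T t x) \<in> {0}}"
  proof (rule subsetD[OF closure_fun_subset A])
    show "orbit_ops \<subseteq> {A. \<forall>x. T t (A x) - A (T t x) \<in> {0}}"
    proof
      fix C assume "C \<in> orbit_ops"
      then obtain s where s: "s0 + s \<in> S" "C = T (s0 + s)"
        using add_in[OF s0(1)] by (auto simp: orbit_ops_def)
      have "T t (C x) = C (T t x)" for x
        using T_add[OF t s(1), of x] T_add[OF s(1) t, of x] s(2) by (simp add: add.commute)
      then show "C \<in> {A. \<forall>x. T t (A x) - A (T t x) \<in> {0}}" by simp
    qed
  qed (auto intro!: continuous_intros continuous_on_eval)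
  then show ?thesis by simp
qed

text \<open>Like all of \<open>orbit_ops\<close>, \<open>P\<close> maps the interval from
  \<open>0\<close> to \<open>h\<close> into the closure of its image under \<open>T s0\<close>.
  Fixed vectors are their own images, so they form a closed part of that compact set.\<close>

lemma compact_fixed_interval:
  assumes P: "P \<in> closure orbit_ops"
  shows "compact {x. P x = x \<and> 0 \<le> x \<and> x \<le> h}"
proof -
  \<comment> \<open>As \<open>p\<close> varies, \<open>inf (pprt p) h\<close> runs through exactly
    the interval from \<open>0\<close> to \<open>h\<close>.\<close>
  have "P \<in> {A. \<forall>p. A (inf (pprt p) h) \<in> closure (T s0 ` {0..h})}"
  proof (rule subsetD[OF closure_fun_subset P])
    show "orbit_ops \<subseteq> {A. \<forall>p. A (inf (pprt p) h) \<in> closure (T s0 ` {0..h})}"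
    proof
      fix C assume "C \<in> orbit_ops"
      then obtain t where t: "t \<in> S" "C = T (s0 + t)" by (auto simp: orbit_ops_def)
      have "C x \<in> closure (T s0 ` {0..h})" if x: "0 \<le> x" "x \<le> h" for x
      proof -
        have "T t x \<in> {0..h}"
          using T_nonneg[OF t(1) x(1)] T_mono[OF t(1) x(2)] T_h[OF t(1)] by simp
        then show ?thesis
          using t orbit_ops_apply closure_subset[of "T s0 ` {0..h}"] by auto
      qed
      then show "C \<in> {A. \<forall>p. A (inf (pprt p) h) \<in> closure (T s0 ` {0..h})}"
        using h by (simp add: quasi_interior_def)
    qed
  qed (auto intro!: continuous_on_eval)
  then have in_closure: "P x \<in> closure (T s0 ` {0..h})" if "0 \<le> x" "x \<le> h" for x
    using that pprt_eq_id[OF that(1)] by (auto dest: spec[of _ x] simp: inf_absorb1)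
  have cont: "continuous_on UNIV P" by (rule J.continuous[OF P])
  have "{x. P x = x \<and> 0 \<le> x \<and> x \<le> h} =
      closure (T s0 ` {0..h}) \<inter> ({x \<in> UNIV. P x - x = 0} \<inter> {0..h})"
    using in_closure by auto metis
  moreover have "compact \<dots>"
  proof (rule compact_Int_closed)
    show "compact (closure (T s0 ` {0..h}))" using s0(2) by (simp add: AM_compact_def)
    show "closed ({x \<in> UNIV. P x - x = 0} \<inter> {0..h})"
      using cont by (intro closed_Int closed_atLeastAtMost_lattice
          continuous_closed_preimage_constant continuous_intros) auto
  qed
  ultimately show ?thesis by simp
qed

text \<open>Some \<open>T (s0 + s)\<close> takes \<open>x\<close> close to \<open>P x\<close>; as
  \<open>P x\<close> is fixed, each further operator enlarges the distance at most by the factor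
  \<open>M\<close>.\<close>

lemma P_in_closure_strongly_convergent:
  assumes P: "P \<in> closure orbit_ops" and fixed: "\<And>t x. t \<in> S \<Longrightarrow> T t (P x) = P x"
  shows "strongly_convergent S T"
  unfolding strongly_convergent_def
proof (intro allI exI impI)
  fix x and \<epsilon> :: real assume \<epsilon>: "\<epsilon> > 0"
  let ?r = "\<epsilon> / (M + 1)"
  have "0 < ?r" using \<epsilon> M_nonneg by simp
  then have "P \<in> (\<lambda>A. A x) -` ball (P x) ?r" by simp
  moreover have "open ((\<lambda>A. A x) -` ball (P x) ?r)"
    by (intro open_vimage continuous_on_eval) auto
  ultimately obtain A where "A \<in> orbit_ops" "A x \<in> ball (P x) ?r"
    using P unfolding closure_iff_nhds_not_empty by blast
  then obtain s where s: "s \<in> S" "dist (T (s0 + s) x) (P x) < ?r"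
    by (auto simp: orbit_ops_def dist_commute)
  have in_S: "s0 + s \<in> S" by (intro add_in s0 s)
  have "norm (T (s0 + s + t) x - P x) \<le> \<epsilon>" if t: "t \<in> S" for t
  proof -
    have "T (s0 + s + t) x - P x = T t (T (s0 + s) x - P x)"
      using T_add[OF t in_S, of x] fixed[OF t] by (simp add: blinfun.diff_right add.commute)
    then have "norm (T (s0 + s + t) x - P x) \<le> M * norm (T (s0 + s) x - P x)"
      using norm_T_apply[OF t] by simp
    also have "\<dots> \<le> (M + 1) * ?r" using s(2) M_nonneg by (intro mult_mono) (auto simp: dist_norm)
    also have "\<dots> = \<epsilon>" using M_nonneg by simp
    finally show ?thesis .
  qed
  then show "\<exists>s\<in>S. \<forall>t\<in>S. norm (T (s + t) x - P x) \<le> \<epsilon>" using in_S by blast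
qed

lemma strongly_convergent: "strongly_convergent S T"
proof -
  obtain P where P: "P \<in> J.kernel" and ker_unit: "\<And>A. A \<in> J.kernel \<Longrightarrow> A \<circ> P = A"
    and inverse: "\<And>A. A \<in> J.kernel \<Longrightarrow> \<exists>B\<in>J.kernel. B \<circ> A = P"
    using J.kernel_group by blast
  have ker: "A \<in> closure orbit_ops" if "A \<in> J.kernel" for A using that J.kernel_subset by blast
  note P' = ker[OF P]
  interpret operator_group P h J.kernel M
  proof
    show "A \<circ> B \<in> J.kernel" if "A \<in> J.kernel" "B \<in> J.kernel" for A B
      by (rule J.kernel_ideal[OF that(2) ker[OF that(1)]])
    show "A (B x) = B (A x)" if "A \<in> J.kernel" "B \<in> J.kernel" for A B x
      using J.comm[OF ker[OF that(1)] ker[OF that(2)]] by (simp add: fun_eq_iff)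
    show "A (P x) = A x" if "A \<in> J.kernel" for A x using ker_unit[OF that] by (simp add: fun_eq_iff)
    show "\<exists>B\<in>J.kernel. \<forall>x. B (A x) = P x" if "A \<in> J.kernel" for A
      using inverse[OF that] by (auto simp: fun_eq_iff)
    show "P (P x) = P x" for x using ker_unit[OF P] by (simp add: fun_eq_iff)
    obtain K where "\<And>x. norm (P x) \<le> norm x * K"
      using bounded_linear.bounded[OF bounded_linear_closure[OF P']] by blast
    then show "\<exists>K. \<forall>x. norm (P x) \<le> norm x * K" by blast
  qed (use P h closure_props ker compact_fixed_interval bounded_linear_closure in
      \<open>auto simp: quasi_interior_def linear_iff\<close>)
  \<comment> \<open>The kernel is an ideal, so each \<open>t\<close> acts on the range of
    \<open>P\<close> as a member of the group.\<close>
  have TP: "T t \<circ> P \<in> J.kernel" if "t \<in> S" for t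
  proof -
    have "(T t \<circ> P) \<circ> P \<in> J.kernel"
      by (rule J.kernel_ideal[OF P T_comp_closure[OF that P']])
    then show ?thesis using ker_unit[OF P] by (simp add: comp_assoc)
  qed
  have P_T: "P (T t x) = T t x" if "t \<in> S" "P x = x" for t x
    using T_commute_closure[OF that(1) P', of x] that(2) by simp
  \<comment> \<open>The root \<open>s\<close> of \<open>t\<close> lies in the generated group,
    possibly outside \<open>S\<close>. Writing \<open>s = a - b\<close> and inverting
    \<open>T b \<circ> P\<close> by \<open>W\<close> gives the group element \<open>V\<close> that
    stands for \<open>T a\<close> divided by \<open>T b\<close>.\<close>
  have roots: "\<exists>V\<in>J.kernel. \<forall>x. P x = x \<longrightarrow> (V ^^ n) x = (T t \<circ> P) x"
    if t: "t \<in> S" and n: "n \<ge> 1" for t n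
  proof -
    obtain s where s: "s \<in> group_closure S" "(\<Sum>i<n. s) = t"
      using divisible group_closure.base[of t S] t n unfolding divisible_def by blast
    obtain a b where ab: "a \<in> S" "b \<in> S" "s = a - b"
      using group_closure_subsemigroup[OF subsemigroup s0(1) s(1)] .
    obtain m where m: "n = Suc m" using n by (cases n) auto
    have pow_in: "(\<Sum>i<Suc k. a) \<in> S" "(\<Sum>i<Suc k. b) \<in> S" for k
      using sum_const_in_subsemigroup[OF subsemigroup] ab by auto
    obtain W where W: "W \<in> J.kernel" "\<And>x. W ((T b \<circ> P) x) = P x"
      using ex_inverse[OF TP[OF ab(2)]] by blast
    define V where "V = (T a \<circ> P) \<circ> W"
    have V: "V \<in> J.kernel" unfolding V_def by (rule comp_in[OF TP[OF ab(1)] W(1)])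
    have V_T: "V (T r x) = T r (V x)" if "r \<in> S" for r x
      using T_commute_closure[OF that ker[OF V]] by simp
    have Vb: "V (T b x) = T a x" if "P x = x" for x
      using W(2)[of x] that by (simp add: V_def P_idem)
    \<comment> \<open>The power of \<open>V\<close> with denominators cleared: multiples of
      \<open>a\<close> and \<open>b\<close> stay in \<open>S\<close>, and \<open>Suc k\<close>
      avoids the empty sum.\<close>
    have Vpow: "(V ^^ Suc k) (T (\<Sum>i<Suc k. b) x) = T (\<Sum>i<Suc k. a) x" if "P x = x" for k x
      using that
    proof (induction k arbitrary: x)
      case 0
      then show ?case using Vb by simp
    next
      case (Suc k)
      let ?a = "\<Sum>i<Suc k. a" and ?b = "\<Sum>i<Suc k. b"
      have "(V ^^ Suc (Suc k)) (T (?b + b) x) = V ((V ^^ Suc k) (T ?b (T b x)))"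
        using T_add[OF pow_in(2) ab(2)] by (simp only: funpow.simps comp_apply)
      also have "\<dots> = V (T ?a (T b x))" by (simp only: Suc.IH[OF P_T[OF ab(2) Suc.prems]])
      also have "\<dots> = T ?a (T a x)" by (simp only: V_T[OF pow_in(1)] Vb[OF Suc.prems])
      also have "\<dots> = T (?a + a) x" using T_add[OF pow_in(1) ab(1)] by simp
      finally show ?case by (simp only: sum.lessThan_Suc)
    qed
    have "(V ^^ n) y = (T t \<circ> P) y" if y: "P y = y" for y
    proof -
      let ?na = "\<Sum>i<n. a" and ?nb = "\<Sum>i<n. b"
      have in_S: "?na \<in> S" "?nb \<in> S" using pow_in[of m] m by auto
      have t_eq: "t + ?nb = ?na" using s(2)[symmetric] ab(3) by (simp add: sum_subtractf)
      \<comment> \<open>\<open>U\<close> inverts \<open>T ?nb\<close> on the range of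
        \<open>P\<close>, so that \<open>y\<close> becomes \<open>T ?nb x\<close> and
        \<open>t + ?nb = ?na\<close> can be used.\<close>
      obtain U where U: "U \<in> J.kernel" "\<And>x. U ((T ?nb \<circ> P) x) = P x"
        using ex_inverse[OF TP[OF in_S(2)]] by blast
      define x where "x = U y"
      have x: "P x = x" using U by (simp add: x_def)
      have y_eq: "T ?nb x = y"
        using commute[OF U(1) TP[OF in_S(2)], of y] U(2)[of y] x y by (simp add: x_def)
      have "(V ^^ n) y = T ?na x" using Vpow[OF x, of m] by (simp only: y_eq[symmetric] m)
      also have "\<dots> = T t y" using T_add[OF t in_S(2), of x] by (simp only: t_eq y_eq)
      finally show ?thesis using y by simp
    qed
    then show ?thesis using V by blast
  qed
  have id: "T t x = x" if "t \<in> S" "P x = x" "0 \<le> x" "x \<le> h" for t x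
    using divisible_eq_id[OF TP[OF that(1)] roots[OF that(1)] that(2-4)] that(2) by simp
  have "T t (P y) = P y" if t: "t \<in> S" and y: "y \<in> principal_ideal h" for t y
  proof -
    obtain c where c: "0 \<le> c" "\<bar>y\<bar> \<le> c *\<^sub>R h" using y by (auto simp: principal_ideal_def)
    \<comment> \<open>Positive even if \<open>c = 0\<close>, so one may divide by it. The vector
      \<open>P y\<close>, which lies between \<open>- (?d *\<^sub>R h)\<close> and
      \<open>?d *\<^sub>R h\<close>, is then moved affinely to \<open>z\<close> between
      \<open>0\<close> and \<open>h\<close>.\<close>
    let ?d = "c + 1"
    have "\<bar>y\<bar> \<le> ?d *\<^sub>R h"
      using c(2) h_nonneg by (simp add: scaleR_left_distrib add_increasing2)
    then have "y \<le> ?d *\<^sub>R h" "- (?d *\<^sub>R h) \<le> y" by (simp_all add: abs_le_iff minus_le_iff)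
    then have Py: "P y \<le> ?d *\<^sub>R h" "- (?d *\<^sub>R h) \<le> P y"
      using P_mono[of y "?d *\<^sub>R h"] P_mono[of "- (?d *\<^sub>R h)" y] by (simp_all add: P.scaleR P.neg P_h)
    define z where "z = (1 / (2 * ?d)) *\<^sub>R (P y + ?d *\<^sub>R h)"
    have "P z = z" by (simp add: z_def P.scaleR P.add P_h P_idem)
    moreover have "0 \<le> z"
    proof -
      have "0 \<le> P y + ?d *\<^sub>R h" using add_right_mono[OF Py(2), of "?d *\<^sub>R h"] by simp
      then show ?thesis using c by (simp add: z_def scaleR_nonneg_nonneg)
    qed
    moreover have "z \<le> h"
    proof -
      have "z \<le> (1 / (2 * ?d)) *\<^sub>R (?d *\<^sub>R h + ?d *\<^sub>R h)"
        unfolding z_def using c Py(1) by (intro scaleR_left_mono add_mono) auto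
      also have "\<dots> = h" using c by (simp flip: scaleR_left_distrib)
      finally show ?thesis .
    qed
    ultimately have "T t z = z" by (rule id[OF t])
    then have "(2 * ?d) *\<^sub>R T t z = (2 * ?d) *\<^sub>R z" by simp
    moreover have "(2 * ?d) *\<^sub>R z = P y + ?d *\<^sub>R h" using c by (simp add: z_def)
    ultimately have "T t (P y + ?d *\<^sub>R h) = P y + ?d *\<^sub>R h"
      by (metis blinfun.scaleR_right)
    then show ?thesis by (simp add: blinfun.add_right blinfun.scaleR_right T_h[OF t])
  qed
  \<comment> \<open>The equality holds on a closed set containing the principal ideal, which is
    dense because \<open>h\<close> is quasi-interior.\<close>
  moreover have "closed {y \<in> UNIV. T t (P y) - P y = 0}" for t
    using J.continuous[OF P'] by (intro continuous_closed_preimage_constant continuous_intros) auto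
  ultimately have "closure (principal_ideal h) \<subseteq> {y \<in> UNIV. T t (P y) - P y = 0}" if "t \<in> S" for t
    using that by (intro closure_minimal) auto
  then have "T t (P x) = P x" if "t \<in> S" for t x
    using that h by (auto simp: quasi_interior_def)
  then show ?thesis by (rule P_in_closure_strongly_convergent[OF P'])
qed

end

theorem theorem3p5:
  fixes S G :: "'g::ab_group_add set"
    and T :: "'g \<Rightarrow> 'e::banach_lattice \<Rightarrow>\<^sub>L 'e"
  assumes "subsemigroup S"
    and "G = group_closure S"
    and "divisible G"
    and "positive_representation S T"
    and "bounded_representation S T"
    and "\<exists>s\<in>S. AM_compact (blinfun_apply (T s))"
    and "\<exists>x. fixed_point S T x \<and> quasi_interior x"
  shows "strongly_convergent S T"
proof -
  obtain s0 where "s0 \<in> S" "AM_compact (blinfun_apply (T s0))" using assms(6) by blast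
  moreover obtain h where "fixed_point S T h" "quasi_interior h" using assms(7) by blast
  moreover obtain M where "\<forall>t\<in>S. norm (T t) \<le> M"
    using assms(5) by (auto simp: bounded_representation_def bounded_iff)
  ultimately interpret AM_compact_representation S T M h s0
    using assms(1-4)
    by unfold_locales
      (auto simp: positive_representation_def representation_def positive_operator_def
        fixed_point_def)
  show ?thesis by (rule strongly_convergent)
qed

end
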